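(* Let $M=gK_I$ be a nearly invariant subspace of $H^2$ with extremal function $g$ and suitable inner function $I$, $I(0)=0$. Then for any Lebesgue measurable function $\varphi$ on $\mathbb{T}$ with $|g|^2\varphi\in L^2$ we have $$U_g^{*}\,A^{M}_{\varphi}\,U_g = A_{|g|^2\varphi},$$ as densely defined operators on $K_I$ with domain $K_I^\infty$.
   Context: $\mathbb{D}$ is the open unit disk, $\mathbb{T}=\partial\mathbb{D}$, $L^p=L^p(\mathbb{T},d\theta/2\pi)$, and $H^2$ is the Hardy space of $\mathbb{D}$ with its usual norm, regarded as a closed subspace of $L^2$ via non-tangential boundary values. For an inner function $I$, $K_I:=H^2\ominus IH^2$ is the model space, with reproducing kernel $k^I_\lambda(z)=\frac{1-\overline{I(\lambda)}I(z)}{1-\overline{\lambda}z}$, $\lambda\in\mathbb{D}$. $P_I$ is the orthogonal projection of $L^2$ onto $K_I$, so $(P_If)(\lambda)=\langle f,k^I_\lambda\rangle=\frac{1}{2\pi}\int_0^{2\pi} f\,\overline{k^I_\lambda}\,d\theta$; since $k^I_\lambda$ is bounded, the same formula defines the function $P_If$ on $\mathbb{D}$ for $f\in L^1$. A closed subspace $M\subset H^2$ is nearly invariant if $f\in M$, $f(0)=0$ imply $f/z\in M$. The extremal function $g$ of a non-zero nearly invariant $M$ is the unique solution of the extremal problem $\sup\{\operatorname{Re} g(0): g\in M,\ \|g\|=1\}$. "Nearly invariant subspace $M=gK_I$ with extremal function $g$ and suitable inner function $I$" means that $M$ is a nearly invariant subspace, $g$ is its extremal function, $I$ is inner with $I(0)=0$,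 $M=gK_I=\{gh:h\in K_I\}$, and the map $U_g:K_I\to M$, $U_gh=gh$, is isometric (hence unitary, with $U_g^*(gh)=h$); by theorems of Hitt and Sarason, such a $g$ has the form $g=a/(1-Ib)$ with $a,b$ in the unit ball of $H^\infty$ and $|a|^2+|b|^2=1$ a.e. on $\mathbb{T}$. Let $K_I^\infty$ be the (dense) set of bounded functions in $K_I$. For $\psi\in L^2$, the truncated Toeplitz operator $A_\psi$ on $K_I$ is densely defined on $K_I^\infty$ by $A_\psi h=P_I(\psi h)$. For $\varphi$ measurable on $\mathbb{T}$ with $|g|^2\varphi\in L^2$, the truncated Toeplitz operator $A^M_\varphi$ on $M$ is densely defined on $gK_I^\infty$ by $A^M_\varphi f=gP_I(\overline{g}\varphi f)$, i.e. $A^M_\varphi(gh)=gP_I(|g|^2\varphi h)$ for $h\in K_I^\infty$ (when $\varphi$ is bounded, this is $P_M(\varphi f)$ with $P_M$ the orthogonal projection of $L^2$ onto $M$). *)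

theory Defs
  imports "HOL-Analysis.Analysis"
begin

text \<open>
  A function on the circle is a map \<open>f :: complex \<Rightarrow> complex\<close> of which only the values \<open>f (cis \<theta>)\<close>
  matter. Functions that agree almost everywhere are not identified; everything below depends
  on such functions through integrals only.
\<close>

definition circle_measurable :: "(complex \<Rightarrow> complex) \<Rightarrow> bool" where
  "circle_measurable f \<longleftrightarrow> (\<lambda>\<theta>. f (cis \<theta>)) \<in> borel_measurable (lebesgue_on {0..2*pi})"

definition L2_circle :: "(complex \<Rightarrow> complex) set" where
  "L2_circle = {f. circle_measurable f \<and>
     integrable (lebesgue_on {0..2*pi}) (\<lambda>\<theta>. (cmod (f (cis \<theta>)))\<^sup>2)}"

definition L2_inner :: "(complex \<Rightarrow> complex) \<Rightarrow> (complex \<Rightarrow> complex) \<Rightarrow> complex" where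
  "L2_inner f k =
     (LINT \<theta>|lebesgue_on {0..2*pi}. f (cis \<theta>) * cnj (k (cis \<theta>))) / of_real (2*pi)"

abbreviation disk :: "complex set" where
  "disk \<equiv> ball 0 1"

text \<open>
  Functions on the disk are elements of \<open>extensional disk\<close>, so that equality in HOL is equality
  on the disk.
\<close>

definition fmult :: "(complex \<Rightarrow> complex) \<Rightarrow> (complex \<Rightarrow> complex) \<Rightarrow> complex \<Rightarrow> complex" where
  "fmult f k = (\<lambda>z\<in>disk. f z * k z)"

definition fdiff :: "(complex \<Rightarrow> complex) \<Rightarrow> (complex \<Rightarrow> complex) \<Rightarrow> complex \<Rightarrow> complex" where
  "fdiff f k = (\<lambda>z\<in>disk. f z - k z)"

definition circle_mean :: "(complex \<Rightarrow> complex) \<Rightarrow> real \<Rightarrow> real" where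
  "circle_mean f r =
     (LINT \<theta>|lebesgue_on {0..2*pi}. (cmod (f (of_real r * cis \<theta>)))\<^sup>2) / (2*pi)"

definition H2 :: "(complex \<Rightarrow> complex) set" where
  "H2 = {f \<in> extensional disk. f holomorphic_on disk \<and> bdd_above (circle_mean f ` {0..<1})}"

definition H2_norm :: "(complex \<Rightarrow> complex) \<Rightarrow> real" where
  "H2_norm f = sqrt (SUP r\<in>{0..<1}. circle_mean f r)"

definition stolz :: "real \<Rightarrow> complex \<Rightarrow> complex set" where
  "stolz \<alpha> \<zeta> = {z \<in> disk. cmod (z - \<zeta>) < \<alpha> * (1 - cmod z)}"

definition has_nt_limit :: "(complex \<Rightarrow> complex) \<Rightarrow> complex \<Rightarrow> complex \<Rightarrow> bool" where
  "has_nt_limit f \<zeta> l \<longleftrightarrow> (\<forall>\<alpha>>1. (f \<longlongrightarrow> l) (at \<zeta> within stolz \<alpha> \<zeta>))"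

text \<open>
  The non-tangential boundary function. For functions in \<open>H2\<close> the limit exists almost everywhere
  (Fatou); where it does not exist the value is an unspecified constant.
\<close>

definition bdry :: "(complex \<Rightarrow> complex) \<Rightarrow> complex \<Rightarrow> complex" where
  "bdry f \<zeta> = (THE l. has_nt_limit f \<zeta> l)"

definition H2_inner :: "(complex \<Rightarrow> complex) \<Rightarrow> (complex \<Rightarrow> complex) \<Rightarrow> complex" where
  "H2_inner f k = L2_inner (bdry f) (bdry k)"

definition closed_subspace_H2 :: "(complex \<Rightarrow> complex) set \<Rightarrow> bool" where
  "closed_subspace_H2 M \<longleftrightarrow>
     M \<subseteq> H2 \<and> (\<lambda>z\<in>disk. 0) \<in> M \<and>
     (\<forall>f\<in>M. \<forall>k\<in>M. (\<lambda>z\<in>disk. f z + k z) \<in> M) \<and>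
     (\<forall>c. \<forall>f\<in>M. (\<lambda>z\<in>disk. c * f z) \<in> M) \<and>
     (\<forall>u f. (\<forall>n. u n \<in> M) \<and> f \<in> H2 \<and> (\<lambda>n::nat. H2_norm (fdiff (u n) f)) \<longlonglongrightarrow> 0 \<longrightarrow> f \<in> M)"

definition inner_function :: "(complex \<Rightarrow> complex) \<Rightarrow> bool" where
  "inner_function I \<longleftrightarrow>
     I \<in> extensional disk \<and> I holomorphic_on disk \<and> bounded (I ` disk) \<and>
     (AE \<theta> in lebesgue_on {0..2*pi}. cmod (bdry I (cis \<theta>)) = 1)"

definition model_space :: "(complex \<Rightarrow> complex) \<Rightarrow> (complex \<Rightarrow> complex) set" where
  "model_space I = {f \<in> H2. \<forall>k\<in>fmult I ` H2. H2_inner f k = 0}"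

definition model_space_bounded :: "(complex \<Rightarrow> complex) \<Rightarrow> (complex \<Rightarrow> complex) set" where
  "model_space_bounded I = {h \<in> model_space I. bounded (h ` disk)}"

text \<open>
  Orthogonal projection onto the model space; meaningful for \<open>f \<in> L2_circle\<close>, where the defining
  condition has a unique solution.
\<close>

definition model_proj ::
  "(complex \<Rightarrow> complex) \<Rightarrow> (complex \<Rightarrow> complex) \<Rightarrow> complex \<Rightarrow> complex" where
  "model_proj I f =
     (THE k. k \<in> model_space I \<and>
        (\<forall>h\<in>model_space I. L2_inner (\<lambda>\<zeta>. f \<zeta> - bdry k \<zeta>) (bdry h) = 0))"

text \<open>The function \<open>k\<close> below is \<open>f/z\<close> with the removable singularity at the origin filled in.\<close>

definition nearly_invariant :: "(complex \<Rightarrow> complex) set \<Rightarrow> bool" where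
  "nearly_invariant M \<longleftrightarrow>
     closed_subspace_H2 M \<and>
     (\<forall>f\<in>M. f 0 = 0 \<longrightarrow> (\<exists>k\<in>M. \<forall>z\<in>disk. f z = z * k z))"

definition solves_extremal_problem ::
  "(complex \<Rightarrow> complex) set \<Rightarrow> (complex \<Rightarrow> complex) \<Rightarrow> bool" where
  "solves_extremal_problem M g \<longleftrightarrow>
     g \<in> M \<and> H2_norm g = 1 \<and> (\<forall>f\<in>M. H2_norm f = 1 \<longrightarrow> Re (f 0) \<le> Re (g 0))"

definition extremal_function ::
  "(complex \<Rightarrow> complex) set \<Rightarrow> (complex \<Rightarrow> complex) \<Rightarrow> bool" where
  "extremal_function M g \<longleftrightarrow>
     solves_extremal_problem M g \<and> (\<forall>f. solves_extremal_problem M f \<longrightarrow> f = g)"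

definition nearly_invariant_rep ::
  "(complex \<Rightarrow> complex) set \<Rightarrow> (complex \<Rightarrow> complex) \<Rightarrow> (complex \<Rightarrow> complex) \<Rightarrow> bool" where
  "nearly_invariant_rep M g I \<longleftrightarrow>
     nearly_invariant M \<and> extremal_function M g \<and> inner_function I \<and> I 0 = 0 \<and>
     M = fmult g ` model_space I \<and>
     (\<forall>h\<in>model_space I. H2_norm (fmult g h) = H2_norm h)"

text \<open>
  Operators between subspaces of \<open>H2\<close> are partial maps, so that \<open>dom\<close> is the domain of the
  operator, \<open>\<circ>\<^sub>m\<close> is composition of operators (on the natural domain), and equality includes
  equality of domains.
\<close>

type_synonym h2_operator = "(complex \<Rightarrow> complex) \<rightharpoonup> (complex \<Rightarrow> complex)"

definition densely_defined_on :: "(complex \<Rightarrow> complex) set \<Rightarrow> h2_operator \<Rightarrow> bool" where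
  "densely_defined_on X T \<longleftrightarrow>
     dom T \<subseteq> X \<and> ran T \<subseteq> X \<and> (\<forall>f\<in>X. \<forall>\<epsilon>>0. \<exists>h\<in>dom T. H2_norm (fdiff f h) < \<epsilon>)"

text \<open>
  Hilbert space adjoint of \<open>T\<close> from \<open>X\<close> to \<open>Y\<close>; the description is unique because \<open>dom T\<close> is
  assumed to be dense in \<open>X\<close>.
\<close>

definition adjoint_op ::
  "(complex \<Rightarrow> complex) set \<Rightarrow> (complex \<Rightarrow> complex) set \<Rightarrow> h2_operator \<Rightarrow> h2_operator" where
  "adjoint_op X Y T f =
     (let is_adj = (\<lambda>k. k \<in> X \<and> (\<forall>h\<in>dom T. H2_inner (the (T h)) f = H2_inner h k))
      in if f \<in> Y \<and> (\<exists>k. is_adj k) then Some (THE k. is_adj k) else None)"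

definition U_op :: "(complex \<Rightarrow> complex) \<Rightarrow> (complex \<Rightarrow> complex) \<Rightarrow> h2_operator" where
  "U_op g I h = (if h \<in> model_space I then Some (fmult g h) else None)"

definition TTO :: "(complex \<Rightarrow> complex) \<Rightarrow> (complex \<Rightarrow> complex) \<Rightarrow> h2_operator" where
  "TTO I \<psi> h =
     (if h \<in> model_space_bounded I then Some (model_proj I (\<lambda>\<zeta>. \<psi> \<zeta> * bdry h \<zeta>)) else None)"

text \<open>
  The truncated Toeplitz operator \<open>f \<mapsto> g P\<^sub>I (cnj g \<phi> f)\<close> on \<open>M = g K\<^sub>I\<close>; the space \<open>M\<close> enters
  through \<open>g\<close> and \<open>I\<close>.
\<close>

definition TTO_nearly ::
  "(complex \<Rightarrow> complex) \<Rightarrow> (complex \<Rightarrow> complex) \<Rightarrow> (complex \<Rightarrow> complex) \<Rightarrow> h2_operator" where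
  "TTO_nearly g I \<phi> f =
     (if f \<in> fmult g ` model_space_bounded I
      then Some (fmult g (model_proj I (\<lambda>\<zeta>. cnj (bdry g \<zeta>) * \<phi> \<zeta> * bdry f \<zeta>)))
      else None)"

end

theory Submission
  imports Defs "HOL-Complex_Analysis.Complex_Analysis"
begin

text \<open>
  Why the identity holds. On boundary values \<open>U\<^sub>g h = g h\<close>, so for bounded \<open>h\<close> in \<open>K\<^sub>I\<close> the function
  \<open>cnj g \<phi> (g h)\<close> under the projection is \<open>\<bar>g\<bar>\<^sup>2 \<phi> h\<close> almost everywhere, and the operator on \<open>M\<close> sends \<open>g h\<close>
  to \<open>g P\<^sub>I (\<bar>g\<bar>\<^sup>2 \<phi> h)\<close>. Polarisation turns the isometry of \<open>U\<^sub>g\<close> into preservation of inner products, so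
  the adjoint of \<open>U\<^sub>g\<close> undoes the multiplication by \<open>g\<close> and leaves \<open>P\<^sub>I (\<bar>g\<bar>\<^sup>2 \<phi> h)\<close>. Injectivity of \<open>U\<^sub>g\<close>
  makes the two domains equal (lemmas \<open>U_adjoint\<close> and \<open>U_injective\<close>).

  Since inner products are integrals of nontangential boundary values, every step rests on the
  boundary behaviour of functions in \<open>H\<^sup>2\<close>. Three facts carry it.

  Fatou's theorem (\<open>Fatou_nontangential\<close>): a function in \<open>H\<^sup>2\<close> has square-summable Taylor coefficients.
  For a polynomial \<open>p\<close>, Poisson's formula applied to \<open>p\<^sup>2\<close> bounds \<open>\<bar>p\<bar>\<^sup>2\<close> on a Stolz region by a multiple of the
  largest average of \<open>\<bar>p\<bar>\<^sup>2\<close> over arcs around the vertex, and a Vitali covering argument bounds the measure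
  of the vertices at which such an average is large by the integral of \<open>\<bar>p\<bar>\<^sup>2\<close>. Applied to blocks of the Taylor
  series, this shows that outside a null set the function is a uniform limit of polynomials on every
  Stolz region, hence has a limit at the vertex.

  Parseval's identity (\<open>bdry_tail\<close>, \<open>bdry_Fourier_coeff\<close>, \<open>L2_normsq_bdry\<close>): Fatou's lemma along radii shows that the Taylor
  polynomials converge to the boundary function in \<open>L\<^sup>2\<close>. So the boundary function has the Taylor
  coefficients as Fourier coefficients and its \<open>L\<^sup>2\<close> norm is the \<open>H\<^sup>2\<close> norm.

  The formula \<open>P\<^sub>I u = P\<^sub>+ u - I P\<^sub>+ (cnj I u)\<close>, with \<open>P\<^sub>+\<close> the Riesz projection, which keeps the Fourier coefficients
  of nonnegative index. It gives the existence of the projection, and it gives the density of the bounded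
  functions: if \<open>u\<close> is a polynomial of degree below \<open>n\<close>, then so is \<open>P\<^sub>+ (cnj I u)\<close>, because \<open>cnj I\<close> has no Fourier
  coefficient of positive index. Thus \<open>P\<^sub>I\<close> maps polynomials to bounded functions, and the images of the
  Taylor polynomials of \<open>f\<close> in \<open>K\<^sub>I\<close> converge to \<open>P\<^sub>I f = f\<close> (lemmas \<open>model_proj_polynomial_bounded\<close> and
  \<open>model_space_bounded_dense\<close>).
\<close>

section \<open>Square-integrable functions on the circle\<close>

abbreviation circ :: "real measure" where
  "circ \<equiv> lebesgue_on {0..2*pi}"

definition L2_normsq :: "(complex \<Rightarrow> complex) \<Rightarrow> real" where
  "L2_normsq f = (LINT \<theta>|circ. (cmod (f (cis \<theta>)))\<^sup>2) / (2*pi)"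

lemma borel_measurable_cnj [measurable]: "cnj \<in> borel_measurable borel"
  by (intro borel_measurable_continuous_onI continuous_intros)

lemma finite_measure_circ: "finite_measure circ"
  by (rule finite_measureI) (simp add: emeasure_restrict_space)

lemma integrable_circ_bounded:
  fixes f :: "real \<Rightarrow> 'b::{banach, second_countable_topology}"
  assumes "f \<in> borel_measurable circ" "AE \<theta> in circ. norm (f \<theta>) \<le> B"
  shows "integrable circ f"
  using finite_measure.integrable_const_bound[OF finite_measure_circ assms(2,1)] .

text \<open>
  Lebesgue measure is complete, so measurability is insensitive to null sets. Nontangential boundary
  functions are controlled only almost everywhere, which is why this is needed.
\<close>

lemma circle_measurable_AE_cong:
  assumes "circle_measurable f" "AE \<theta> in circ. f (cis \<theta>) = k (cis \<theta>)"
  shows "circle_measurable k"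
proof -
  have "(\<lambda>\<theta>. if \<theta> \<in> {0..2*pi} then f (cis \<theta>) else 0) \<in> borel_measurable lebesgue"
    using assms(1) by (simp add: circle_measurable_def del: atLeastAtMost_iff flip: measurable_restrict_space_iff)
  moreover have "AE \<theta> in lebesgue. (if \<theta> \<in> {0..2*pi} then f (cis \<theta>) else 0)
      = (if \<theta> \<in> {0..2*pi} then k (cis \<theta>) else 0)"
    using assms(2) by (subst (asm) AE_restrict_space_iff) (auto elim: eventually_mono)
  ultimately have "(\<lambda>\<theta>. if \<theta> \<in> {0..2*pi} then k (cis \<theta>) else 0) \<in> borel_measurable lebesgue"
    by (rule borel_measurable_AE)
  then show ?thesis
    by (simp add: circle_measurable_def del: atLeastAtMost_iff flip: measurable_restrict_space_iff)
qed

lemma circle_measurable_continuous: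
  assumes "continuous_on (sphere 0 1) f"
  shows "circle_measurable f"
proof -
  have "continuous_on {0..2*pi} (\<lambda>\<theta>. f (cis \<theta>))"
    by (rule continuous_on_compose2[OF assms]) (auto intro!: continuous_intros)
  then show ?thesis
    unfolding circle_measurable_def
    by (rule continuous_imp_measurable_on_sets_lebesgue) simp
qed

lemma circle_measurable_diff [intro]:
  "circle_measurable f \<Longrightarrow> circle_measurable k \<Longrightarrow> circle_measurable (\<lambda>\<zeta>. f \<zeta> - k \<zeta>)"
  unfolding circle_measurable_def by measurable

lemma circle_measurable_add [intro]:
  "circle_measurable f \<Longrightarrow> circle_measurable k \<Longrightarrow> circle_measurable (\<lambda>\<zeta>. f \<zeta> + k \<zeta>)"
  unfolding circle_measurable_def by measurable

lemma circle_measurable_mult [intro]: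
  "circle_measurable f \<Longrightarrow> circle_measurable k \<Longrightarrow> circle_measurable (\<lambda>\<zeta>. f \<zeta> * k \<zeta>)"
  unfolding circle_measurable_def by measurable

lemma circle_measurable_cnj [intro]:
  "circle_measurable f \<Longrightarrow> circle_measurable (\<lambda>\<zeta>. cnj (f \<zeta>))"
  unfolding circle_measurable_def by measurable

lemma L2_circle_measurable: "f \<in> L2_circle \<Longrightarrow> circle_measurable f"
  by (simp add: L2_circle_def)

lemma L2_circle_integrable: "f \<in> L2_circle \<Longrightarrow> integrable circ (\<lambda>\<theta>. (cmod (f (cis \<theta>)))\<^sup>2)"
  by (simp add: L2_circle_def)

lemma L2_circle_bounded:
  assumes "circle_measurable f" "AE \<theta> in circ. cmod (f (cis \<theta>)) \<le> B"
  shows "f \<in> L2_circle"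
proof -
  have "integrable circ (\<lambda>\<theta>. (cmod (f (cis \<theta>)))\<^sup>2)"
  proof (rule integrable_circ_bounded)
    show "(\<lambda>\<theta>. (cmod (f (cis \<theta>)))\<^sup>2) \<in> borel_measurable circ"
      using assms(1) unfolding circle_measurable_def by measurable
    show "AE \<theta> in circ. norm ((cmod (f (cis \<theta>)))\<^sup>2) \<le> B\<^sup>2"
      using assms(2) by eventually_elim (simp add: power_mono)
  qed
  with assms(1) show ?thesis by (simp add: L2_circle_def)
qed

lemma L2_circle_continuous:
  assumes "continuous_on (sphere 0 1) f"
  shows "f \<in> L2_circle"
proof -
  have "bounded (f ` sphere 0 1)"
    by (rule compact_imp_bounded, rule compact_continuous_image[OF assms]) simp
  then obtain B where "\<forall>\<zeta>\<in>sphere 0 1. cmod (f \<zeta>) \<le> B"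
    by (auto simp: bounded_iff)
  then show ?thesis
    by (intro L2_circle_bounded[where B = B] circle_measurable_continuous assms AE_I2) auto
qed

lemma L2_circle_mult_bounded:
  assumes f: "f \<in> L2_circle" and b: "circle_measurable b" "AE \<theta> in circ. cmod (b (cis \<theta>)) \<le> B"
  shows "(\<lambda>\<zeta>. f \<zeta> * b \<zeta>) \<in> L2_circle"
proof -
  have "integrable circ (\<lambda>\<theta>. (cmod (f (cis \<theta>) * b (cis \<theta>)))\<^sup>2)"
  proof (rule Bochner_Integration.integrable_bound)
    show "integrable circ (\<lambda>\<theta>. B\<^sup>2 * (cmod (f (cis \<theta>)))\<^sup>2)"
      using L2_circle_integrable[OF f] by simp
    show "(\<lambda>\<theta>. (cmod (f (cis \<theta>) * b (cis \<theta>)))\<^sup>2) \<in> borel_measurable circ"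
      using L2_circle_measurable[OF f] b(1) unfolding circle_measurable_def by measurable
    show "AE \<theta> in circ. norm ((cmod (f (cis \<theta>) * b (cis \<theta>)))\<^sup>2) \<le> norm (B\<^sup>2 * (cmod (f (cis \<theta>)))\<^sup>2)"
      using b(2)
    proof eventually_elim
      case (elim \<theta>)
      have "(cmod (b (cis \<theta>)))\<^sup>2 \<le> B\<^sup>2" using elim by (simp add: power_mono)
      then show ?case by (simp add: norm_mult power_mult_distrib mult_right_mono mult.commute)
    qed
  qed
  then show ?thesis
    using circle_measurable_mult[OF L2_circle_measurable[OF f] b(1)] by (simp add: L2_circle_def)
qed

lemma L2_circle_cmult: "f \<in> L2_circle \<Longrightarrow> (\<lambda>\<zeta>. c * f \<zeta>) \<in> L2_circle"
  using L2_circle_mult_bounded[of f "\<lambda>_. c" "cmod c"]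
  by (simp add: mult.commute circle_measurable_def)

lemma cmod_add_square_le: "(cmod (x + y))\<^sup>2 \<le> 2 * (cmod x)\<^sup>2 + 2 * (cmod y)\<^sup>2"
proof -
  have "(cmod (x + y))\<^sup>2 \<le> (cmod x + cmod y)\<^sup>2"
    by (intro power_mono norm_triangle_ineq) auto
  also have "\<dots> \<le> 2 * (cmod x)\<^sup>2 + 2 * (cmod y)\<^sup>2"
    using sum_squares_bound[of "cmod x" "cmod y"] by (simp add: power2_sum)
  finally show ?thesis .
qed

lemma L2_circle_add:
  assumes "f \<in> L2_circle" "k \<in> L2_circle"
  shows "(\<lambda>\<zeta>. f \<zeta> + k \<zeta>) \<in> L2_circle"
proof -
  have "integrable circ (\<lambda>\<theta>. (cmod (f (cis \<theta>) + k (cis \<theta>)))\<^sup>2)"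
  proof (rule Bochner_Integration.integrable_bound)
    show "integrable circ (\<lambda>\<theta>. 2 * (cmod (f (cis \<theta>)))\<^sup>2 + 2 * (cmod (k (cis \<theta>)))\<^sup>2)"
      using assms[THEN L2_circle_integrable] by simp
    show "(\<lambda>\<theta>. (cmod (f (cis \<theta>) + k (cis \<theta>)))\<^sup>2) \<in> borel_measurable circ"
      using assms[THEN L2_circle_measurable] unfolding circle_measurable_def by measurable
    show "AE \<theta> in circ. norm ((cmod (f (cis \<theta>) + k (cis \<theta>)))\<^sup>2)
        \<le> norm (2 * (cmod (f (cis \<theta>)))\<^sup>2 + 2 * (cmod (k (cis \<theta>)))\<^sup>2)"
      by (simp add: cmod_add_square_le)
  qed
  then show ?thesis
    using circle_measurable_add assms[THEN L2_circle_measurable] by (simp add: L2_circle_def)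
qed

lemma L2_circle_diff:
  assumes "f \<in> L2_circle" "k \<in> L2_circle"
  shows "(\<lambda>\<zeta>. f \<zeta> - k \<zeta>) \<in> L2_circle"
  using L2_circle_add[OF assms(1) L2_circle_cmult[OF assms(2), of "-1"]] by simp

lemma L2_inner_integrable:
  assumes "f \<in> L2_circle" "k \<in> L2_circle"
  shows "integrable circ (\<lambda>\<theta>. f (cis \<theta>) * cnj (k (cis \<theta>)))"
proof (rule Bochner_Integration.integrable_bound)
  show "integrable circ (\<lambda>\<theta>. (cmod (f (cis \<theta>)))\<^sup>2 + (cmod (k (cis \<theta>)))\<^sup>2)"
    using assms[THEN L2_circle_integrable] by simp
  show "(\<lambda>\<theta>. f (cis \<theta>) * cnj (k (cis \<theta>))) \<in> borel_measurable circ"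
    using assms[THEN L2_circle_measurable] unfolding circle_measurable_def by measurable
  have "x * y \<le> x\<^sup>2 + y\<^sup>2" if "x \<ge> 0" "y \<ge> 0" for x y :: real
    using sum_squares_bound[of x y] mult_nonneg_nonneg[OF that] by linarith
  then show "AE \<theta> in circ. norm (f (cis \<theta>) * cnj (k (cis \<theta>)))
      \<le> norm ((cmod (f (cis \<theta>)))\<^sup>2 + (cmod (k (cis \<theta>)))\<^sup>2)"
    by (simp add: norm_mult)
qed

lemma L2_inner_commute: "L2_inner k f = cnj (L2_inner f k)"
  by (simp add: L2_inner_def mult.commute flip: Bochner_Integration.integral_cnj)

lemma L2_inner_add_left:
  "f \<in> L2_circle \<Longrightarrow> k \<in> L2_circle \<Longrightarrow> h \<in> L2_circle \<Longrightarrow>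
    L2_inner (\<lambda>\<zeta>. f \<zeta> + k \<zeta>) h = L2_inner f h + L2_inner k h"
  by (simp add: L2_inner_def distrib_right L2_inner_integrable add_divide_distrib)

lemma L2_inner_cmult_left: "L2_inner (\<lambda>\<zeta>. c * f \<zeta>) h = c * L2_inner f h"
  by (simp add: L2_inner_def mult.assoc)

lemma L2_inner_diff_left:
  "f \<in> L2_circle \<Longrightarrow> k \<in> L2_circle \<Longrightarrow> h \<in> L2_circle \<Longrightarrow>
    L2_inner (\<lambda>\<zeta>. f \<zeta> - k \<zeta>) h = L2_inner f h - L2_inner k h"
  by (simp add: L2_inner_def left_diff_distrib L2_inner_integrable diff_divide_distrib)

lemma L2_inner_diff_right:
  "f \<in> L2_circle \<Longrightarrow> k \<in> L2_circle \<Longrightarrow> h \<in> L2_circle \<Longrightarrow>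
    L2_inner h (\<lambda>\<zeta>. f \<zeta> - k \<zeta>) = L2_inner h f - L2_inner h k"
  by (simp add: L2_inner_commute[of h] L2_inner_diff_left)

lemma L2_inner_cmult_right: "L2_inner h (\<lambda>\<zeta>. c * f \<zeta>) = cnj c * L2_inner h f"
  by (simp add: L2_inner_commute[of h] L2_inner_cmult_left)

lemma L2_circle_sum:
  "(\<And>i. i \<in> A \<Longrightarrow> F i \<in> L2_circle) \<Longrightarrow> (\<lambda>\<zeta>. \<Sum>i\<in>A. F i \<zeta>) \<in> L2_circle"
proof (induction A rule: infinite_finite_induct)
  case (insert x A)
  then show ?case using L2_circle_add[of "F x" "\<lambda>\<zeta>. \<Sum>i\<in>A. F i \<zeta>"] by simp
qed (auto intro!: L2_circle_continuous)

lemma L2_inner_sum_left: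
  "(\<And>i. i \<in> A \<Longrightarrow> F i \<in> L2_circle) \<Longrightarrow> h \<in> L2_circle \<Longrightarrow>
     L2_inner (\<lambda>\<zeta>. \<Sum>i\<in>A. F i \<zeta>) h = (\<Sum>i\<in>A. L2_inner (F i) h)"
proof (induction A rule: infinite_finite_induct)
  case (insert x A)
  then show ?case by (simp add: L2_inner_add_left L2_circle_sum)
qed (simp_all add: L2_inner_def)

lemma L2_inner_sum_right:
  "(\<And>i. i \<in> A \<Longrightarrow> F i \<in> L2_circle) \<Longrightarrow> h \<in> L2_circle \<Longrightarrow>
     L2_inner h (\<lambda>\<zeta>. \<Sum>i\<in>A. F i \<zeta>) = (\<Sum>i\<in>A. L2_inner h (F i))"
  by (simp add: L2_inner_commute[of h] L2_inner_sum_left)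

lemma L2_inner_AE_cong:
  assumes "circle_measurable f" "circle_measurable f'" "circle_measurable k" "circle_measurable k'"
    "AE \<theta> in circ. f (cis \<theta>) = f' (cis \<theta>)" "AE \<theta> in circ. k (cis \<theta>) = k' (cis \<theta>)"
  shows "L2_inner f k = L2_inner f' k'"
proof -
  have "(LINT \<theta>|circ. f (cis \<theta>) * cnj (k (cis \<theta>))) = (LINT \<theta>|circ. f' (cis \<theta>) * cnj (k' (cis \<theta>)))"
  proof (rule integral_cong_AE)
    show "AE \<theta> in circ. f (cis \<theta>) * cnj (k (cis \<theta>)) = f' (cis \<theta>) * cnj (k' (cis \<theta>))"
      using assms(5,6) by eventually_elim simp
  qed (use circle_measurable_mult[OF assms(1) circle_measurable_cnj[OF assms(3)]]
      circle_measurable_mult[OF assms(2) circle_measurable_cnj[OF assms(4)]]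
      in \<open>simp_all add: circle_measurable_def\<close>)
  then show ?thesis by (simp add: L2_inner_def)
qed

lemma L2_inner_self: "L2_inner f f = of_real (L2_normsq f)"
  by (simp add: L2_inner_def L2_normsq_def complex_norm_square[symmetric] flip: integral_of_real)
   (simp add: flip: of_real_power)

lemma L2_normsq_nonneg: "0 \<le> L2_normsq f"
  by (simp add: L2_normsq_def)

lemma L2_normsq_diff:
  assumes "f \<in> L2_circle" "k \<in> L2_circle"
  shows "L2_normsq (\<lambda>\<zeta>. f \<zeta> - k \<zeta>) = L2_normsq f + L2_normsq k - 2 * Re (L2_inner f k)"
proof -
  have "of_real (L2_normsq (\<lambda>\<zeta>. f \<zeta> - k \<zeta>)) = 
      L2_inner f f + L2_inner k k - (L2_inner f k + cnj (L2_inner f k))"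
    by (simp add: L2_inner_diff_left L2_inner_diff_right L2_circle_diff assms algebra_simps
        flip: L2_inner_self L2_inner_commute)
  also have "\<dots> = of_real (L2_normsq f + L2_normsq k - 2 * Re (L2_inner f k))"
    by (simp add: L2_inner_self complex_add_cnj)
  finally show ?thesis unfolding of_real_eq_iff .
qed

lemma L2_normsq_cmult: "L2_normsq (\<lambda>\<zeta>. c * f \<zeta>) = (cmod c)\<^sup>2 * L2_normsq f"
  by (simp add: L2_normsq_def norm_mult power_mult_distrib)

text \<open>
  The squared norm of \<open>f - t c k\<close> with \<open>c = \<langle>f, k\<rangle>\<close> is a nonnegative quadratic polynomial in the real variable \<open>t\<close>;
  the inequality is read off at its minimum.
\<close>

lemma L2_Cauchy_Schwarz:
  assumes "f \<in> L2_circle" "k \<in> L2_circle"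
  shows "(cmod (L2_inner f k))\<^sup>2 \<le> L2_normsq f * L2_normsq k"
proof -
  define c where "c = L2_inner f k"
  have *: "2 * t * (cmod c)\<^sup>2 \<le> L2_normsq f + t\<^sup>2 * (cmod c)\<^sup>2 * L2_normsq k" for t :: real
  proof -
    have "0 \<le> L2_normsq (\<lambda>\<zeta>. f \<zeta> - of_real t * c * k \<zeta>)" by (rule L2_normsq_nonneg)
    also have "\<dots> = L2_normsq f + t\<^sup>2 * (cmod c)\<^sup>2 * L2_normsq k - 2 * Re (cnj (of_real t * c) * c)"
      using L2_normsq_diff[OF assms(1) L2_circle_cmult[OF assms(2), of "of_real t * c"]]
      by (simp add: L2_normsq_cmult L2_inner_cmult_right norm_mult power_mult_distrib c_def)
    also have "cnj (of_real t * c) * c = of_real (t * (cmod c)\<^sup>2)"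
      by (simp add: complex_norm_square mult_ac del: of_real_power)
    finally show ?thesis by simp
  qed
  show ?thesis
  proof (cases "L2_normsq k = 0")
    case True
    have "cmod c = 0"
    proof (rule ccontr)
      assume "cmod c \<noteq> 0"
      then show False
        using *[of "(L2_normsq f + 1) / (cmod c)\<^sup>2"] True L2_normsq_nonneg[of f] by simp
    qed
    then show ?thesis using True by (simp add: c_def)
  next
    case False
    then have "L2_normsq k > 0" using L2_normsq_nonneg[of k] by linarith
    with *[of "1 / L2_normsq k"] show ?thesis
      by (simp add: c_def field_simps power2_eq_square)
  qed
qed

section \<open>Cauchy and Poisson integrals on the circle\<close>

lemma integrable_circ_continuous:
  fixes f :: "real \<Rightarrow> 'b::euclidean_space"
  shows "continuous_on {0..2*pi} f \<Longrightarrow> integrable circ f"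
  by (rule continuous_imp_integrable_real)

text \<open>
  Cauchy's formula in angular form. The case \<open>z = 0\<close> is the mean value property, which yields the orthogonality of the monomials, and a
  general \<open>z\<close> yields the Poisson formula.
\<close>

lemma Cauchy_integral_circle:
  assumes cont: "continuous_on (cball 0 1) f" and hol: "f holomorphic_on ball 0 1" and z: "cmod z < 1"
  shows "(LINT \<theta>|circ. f (cis \<theta>) * cis \<theta> / (cis \<theta> - z)) = of_real (2*pi) * f z"
proof -
  have ne: "cis \<theta> \<noteq> z" for \<theta> using z by auto
  have "continuous_on {0..2*pi} (\<lambda>\<theta>. f (cis \<theta>) * cis \<theta> / (cis \<theta> - z))"
    by (intro continuous_intros continuous_on_compose2[OF cont]) (auto simp: ne)
  then have int: "integrable circ (\<lambda>\<theta>. f (cis \<theta>) * cis \<theta> / (cis \<theta> - z))"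
    by (rule integrable_circ_continuous)
  have "((\<lambda>u. f u / (u - z)) has_contour_integral (2 * of_real pi * \<i> * f z)) (part_circlepath 0 1 0 (2*pi))"
    using Cauchy_integral_circlepath[OF cont hol, of z] z by (simp add: circlepath_def)
  then have "((\<lambda>t. f (cis t) / (cis t - z) * \<i> * cis t) has_integral (2 * of_real pi * \<i> * f z)) {0..2*pi}"
    by (subst (asm) has_contour_integral_part_circlepath_iff) auto
  then have "((\<lambda>t. - \<i> * (f (cis t) / (cis t - z) * \<i> * cis t)) has_integral (- \<i> * (2 * of_real pi * \<i> * f z))) {0..2*pi}"
    by (rule has_integral_mult_right)
  then have "((\<lambda>t. f (cis t) * cis t / (cis t - z)) has_integral (of_real (2*pi) * f z)) {0..2*pi}"
    by (simp add: mult_ac)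
  then show ?thesis
    using lebesgue_integral_eq_integral[OF int] by (simp add: integral_unique)
qed

lemma L2_inner_monomials:
  "L2_inner (\<lambda>\<zeta>. \<zeta> ^ j) (\<lambda>\<zeta>. \<zeta> ^ k) = (if j = k then 1 else 0)"
proof -
  have *: "L2_inner (\<lambda>\<zeta>. \<zeta> ^ j) (\<lambda>\<zeta>. \<zeta> ^ k) = (if j = k then 1 else 0)" if "k \<le> j" for j k
  proof -
    have unit: "cis \<theta> ^ k * cnj (cis \<theta> ^ k) = 1" for \<theta>
      by (simp add: cis_cnj cis_mult flip: power_mult_distrib)
    have "cis \<theta> ^ j * cnj (cis \<theta> ^ k) = cis \<theta> ^ (j - k) * cis \<theta> / (cis \<theta> - 0)" for \<theta>
    proof -
      have "cis \<theta> ^ j = cis \<theta> ^ (j - k) * cis \<theta> ^ k" using that by (simp flip: power_add)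
      then show ?thesis using unit[of \<theta>] by (simp add: mult.assoc del: complex_cnj_power)
    qed
    then have "L2_inner (\<lambda>\<zeta>. \<zeta> ^ j) (\<lambda>\<zeta>. \<zeta> ^ k) = 0 ^ (j - k)"
      using Cauchy_integral_circle[of "\<lambda>z. z ^ (j - k)" 0]
      unfolding L2_inner_def by (simp add: holomorphic_intros continuous_intros)
    then show ?thesis using that by (simp add: power_0_left)
  qed
  show ?thesis
  proof (cases "k \<le> j")
    case True
    then show ?thesis by (rule *)
  next
    case False
    then have "L2_inner (\<lambda>\<zeta>. \<zeta> ^ k) (\<lambda>\<zeta>. \<zeta> ^ j) = 0"
      by (subst *) auto
    then show ?thesis using False by (subst L2_inner_commute) auto
  qed
qed

lemma L2_circle_monomial: "(\<lambda>\<zeta>. c * \<zeta> ^ k) \<in> L2_circle"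
  by (intro L2_circle_continuous continuous_intros)

lemma L2_circle_power: "(\<lambda>\<zeta>. \<zeta> ^ k) \<in> L2_circle"
  by (intro L2_circle_continuous continuous_intros)

lemma L2_circle_polynomial: "(\<lambda>\<zeta>. \<Sum>k\<in>A. c k * \<zeta> ^ k) \<in> L2_circle"
  by (intro L2_circle_continuous continuous_intros)

lemma L2_inner_polynomial_monomial:
  assumes "finite A"
  shows "L2_inner (\<lambda>\<zeta>. \<Sum>k\<in>A. c k * \<zeta> ^ k) (\<lambda>\<zeta>. \<zeta> ^ j) = (if j \<in> A then c j else 0)"
  using assms
  by (simp add: L2_inner_sum_left L2_circle_monomial L2_circle_power L2_inner_cmult_left
      L2_inner_monomials if_distrib[of "(*) _"] sum.delta' cong: if_cong)

lemma L2_normsq_polynomial: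
  assumes "finite A"
  shows "L2_normsq (\<lambda>\<zeta>. \<Sum>k\<in>A. c k * \<zeta> ^ k) = (\<Sum>k\<in>A. (cmod (c k))\<^sup>2)"
proof -
  have "of_real (L2_normsq (\<lambda>\<zeta>. \<Sum>k\<in>A. c k * \<zeta> ^ k)) = (\<Sum>k\<in>A. c k * cnj (c k))"
    using assms by (simp add: L2_inner_sum_right[where F = "\<lambda>k \<zeta>. c k * \<zeta> ^ k"] L2_circle_monomial L2_circle_polynomial
      L2_inner_cmult_right L2_inner_polynomial_monomial mult.commute flip: L2_inner_self)
  also have "\<dots> = of_real (\<Sum>k\<in>A. (cmod (c k))\<^sup>2)"
    by (simp add: complex_norm_square del: of_real_power)
  finally show ?thesis unfolding of_real_eq_iff .
qed

text \<open>
  Cauchy's formula at \<open>z\<close> for \<open>h w = f w (1 - \<bar>z\<bar>\<^sup>2) / (1 - cnj z w)\<close>, which agrees with \<open>f\<close> at \<open>z\<close>: on the unit circle the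
  extra factor turns the Cauchy kernel into the Poisson kernel.
\<close>

lemma Poisson_integral:
  assumes cont: "continuous_on (cball 0 1) f" and hol: "f holomorphic_on ball 0 1" and z: "cmod z < 1"
  shows "(LINT \<theta>|circ. f (cis \<theta>) * of_real ((1 - (cmod z)\<^sup>2) / (cmod (cis \<theta> - z))\<^sup>2)) = of_real (2*pi) * f z"
proof -
  define h where "h w = f w * of_real (1 - (cmod z)\<^sup>2) / (1 - cnj z * w)" for w
  have ne: "1 - cnj z * w \<noteq> 0" if "cmod w \<le> 1" for w
  proof
    assume "1 - cnj z * w = 0"
    then have "cmod (cnj z * w) = 1" by simp
    moreover have "cmod (cnj z * w) < 1"
      using z that mult_left_le[of "cmod w" "cmod z"] by (simp add: norm_mult)
    ultimately show False by simp
  qed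
  have ne1: "cis \<theta> - z \<noteq> 0" for \<theta> using z by auto
  have "of_real (1 - (cmod z)\<^sup>2) = 1 - cnj z * z"
    using complex_norm_square[of z] by (simp add: mult.commute)
  then have hz: "h z = f z"
    using ne[of z] z by (simp add: h_def)
  have key: "h (cis \<theta>) * cis \<theta> / (cis \<theta> - z) = f (cis \<theta>) * of_real ((1 - (cmod z)\<^sup>2) / (cmod (cis \<theta> - z))\<^sup>2)" for \<theta>
  proof -
    have "(cis \<theta> - z) * (1 - cnj z * cis \<theta>) = cis \<theta> * (cis \<theta> - z) * cnj (cis \<theta> - z)"
      by (simp add: algebra_simps cis_cnj flip: cis_mult)
        (simp add: cis_mult)
    also have "\<dots> = cis \<theta> * of_real ((cmod (cis \<theta> - z))\<^sup>2)"
      by (simp only: complex_norm_square mult.assoc)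
    finally have *: "(cis \<theta> - z) * (1 - cnj z * cis \<theta>) = cis \<theta> * of_real ((cmod (cis \<theta> - z))\<^sup>2)" .
    have "h (cis \<theta>) * cis \<theta> / (cis \<theta> - z)
        = f (cis \<theta>) * of_real (1 - (cmod z)\<^sup>2) * (cis \<theta> / ((cis \<theta> - z) * (1 - cnj z * cis \<theta>)))"
      by (simp add: h_def mult_ac)
    also have "cis \<theta> / ((cis \<theta> - z) * (1 - cnj z * cis \<theta>)) = 1 / of_real ((cmod (cis \<theta> - z))\<^sup>2)"
      unfolding * by simp
    finally show ?thesis by simp
  qed
  have "(LINT \<theta>|circ. h (cis \<theta>) * cis \<theta> / (cis \<theta> - z)) = of_real (2*pi) * h z"
  proof (rule Cauchy_integral_circle[OF _ _ z])
    show "continuous_on (cball 0 1) h"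
      unfolding h_def by (intro continuous_intros cont) (use ne in auto)
    show "h holomorphic_on ball 0 1"
      unfolding h_def by (intro holomorphic_intros hol) (use ne in auto)
  qed
  then show ?thesis unfolding key hz .
qed

text \<open>
  The Poisson formula for the holomorphic function \<open>f\<^sup>2\<close>. Passing to the square here is what allows a maximal
  inequality for integrable functions to yield an estimate in terms of the \<open>L\<^sup>2\<close> norm.
\<close>

lemma Poisson_bound_normsq:
  assumes cont: "continuous_on (cball 0 1) f" and hol: "f holomorphic_on ball 0 1" and z: "cmod z < 1"
  shows "2*pi * (cmod (f z))\<^sup>2
    \<le> (LINT \<theta>|circ. (cmod (f (cis \<theta>)))\<^sup>2 * ((1 - (cmod z)\<^sup>2) / (cmod (cis \<theta> - z))\<^sup>2))"
proof -
  have "1 - (cmod z)\<^sup>2 \<ge> 0" using z by (simp add: power_le_one)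
  then have eq: "cmod ((f (cis \<theta>))\<^sup>2 * of_real ((1 - (cmod z)\<^sup>2) / (cmod (cis \<theta> - z))\<^sup>2))
      = (cmod (f (cis \<theta>)))\<^sup>2 * ((1 - (cmod z)\<^sup>2) / (cmod (cis \<theta> - z))\<^sup>2)" for \<theta>
    by (simp add: norm_mult norm_power norm_divide del: of_real_divide of_real_power of_real_diff)
  have "2*pi * (cmod (f z))\<^sup>2 = cmod (of_real (2*pi) * (f z)\<^sup>2)"
    by (simp add: norm_mult norm_power)
  also have "\<dots> = cmod (LINT \<theta>|circ. (f (cis \<theta>))\<^sup>2 * of_real ((1 - (cmod z)\<^sup>2) / (cmod (cis \<theta> - z))\<^sup>2))"
    by (subst Poisson_integral[OF _ _ z]) (auto intro!: continuous_intros holomorphic_intros cont hol)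
  also have "\<dots> \<le> (LINT \<theta>|circ. (cmod (f (cis \<theta>)))\<^sup>2 * ((1 - (cmod z)\<^sup>2) / (cmod (cis \<theta> - z))\<^sup>2))"
    by (rule order_trans[OF integral_norm_bound]) (simp only: eq)
  finally show ?thesis .
qed

section \<open>The maximal inequality and nontangential approach\<close>

text \<open>
  Arcs are cut out by discs in the plane rather than by angles, so that no periodicity has to be tracked and
  covering lemmas for balls apply.
\<close>

definition circ_arc :: "real \<Rightarrow> real \<Rightarrow> real set" where
  "circ_arc \<theta> h = {t \<in> {0..2*pi}. cmod (cis t - cis \<theta>) \<le> h}"

lemma sin_ge_half:
  fixes s :: real
  assumes "0 \<le> s" "s \<le> pi/2"
  shows "s / 2 \<le> sin s"
proof -
  \<comment> \<open>\<open>sin (2 u) = 2 tan u cos\<^sup>2 u\<close>, where \<open>tan u \<ge> u\<close> and \<open>cos\<^sup>2 u \<ge> 1/2\<close> for \<open>0 \<le> u \<le> \<pi>/4\<close>\<close>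
  define u where "u = s / 2"
  have u: "0 \<le> u" "u \<le> pi/4" using assms by (auto simp: u_def)
  have "cos (pi/4) \<le> cos u" using u by (intro cos_monotone_0_pi_le) auto
  then have "(cos (pi/4))\<^sup>2 \<le> (cos u)\<^sup>2" by (intro power_mono) (auto simp: cos_45)
  then have c: "1/2 \<le> (cos u)\<^sup>2" by (simp add: cos_45 power_divide)
  then have "cos u \<noteq> 0" by auto
  have "\<bar>u\<bar> \<le> \<bar>tan u\<bar>" using u pi_gt_zero by (intro abs_tan_ge) linarith
  moreover have "0 \<le> tan u" using u pi_gt_zero by (intro tan_pos_pi2_le) linarith+
  ultimately have t: "u \<le> tan u" using u by simp
  have "s / 2 = 2 * (u * (1/2))" by (simp add: u_def)
  also have "\<dots> \<le> 2 * (tan u * (cos u)\<^sup>2)"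
    using t c u by (intro mult_left_mono mult_mono) auto
  also have "\<dots> = sin (2 * u)"
    using \<open>cos u \<noteq> 0\<close> by (simp add: tan_def power2_eq_square sin_double)
  finally show ?thesis by (simp add: u_def)
qed

lemma cmod_cis_diff: "cmod (cis t - cis \<theta>) = 2 * \<bar>sin ((t - \<theta>) / 2)\<bar>"
proof -
  have "cis t - cis \<theta> = cis \<theta> * (cis (t - \<theta>) - 1)"
    by (simp add: algebra_simps cis_mult)
  then have "cmod (cis t - cis \<theta>) = cmod (cis (t - \<theta>) - 1)"
    by (simp add: norm_mult)
  also have "\<dots> = 2 * \<bar>sin ((t - \<theta>) / 2)\<bar>"
    using dist_exp_i_1[of "t - \<theta>"] by (simp add: cis_conv_exp)
  finally show ?thesis .
qed

text \<open>
  The chord length is \<open>2 \<bar>sin ((t - \<theta>) / 2)\<bar>\<close>, so a short chord forces \<open>t\<close> to be near \<open>\<theta>\<close>, or forces \<open>t\<close> and \<open>\<theta>\<close> to lie near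
  opposite ends of \<open>[0, 2\<pi>]\<close>; the last two intervals account for the wrap-around.
\<close>

lemma circ_arc_subset:
  assumes "\<theta> \<in> {0..2*pi}"
  shows "circ_arc \<theta> h \<subseteq> {\<theta> - 2*h..\<theta> + 2*h} \<union> {0..2*h} \<union> {2*pi - 2*h..2*pi}"
proof
  fix t assume "t \<in> circ_arc \<theta> h"
  then have t: "t \<in> {0..2*pi}" and le: "2 * \<bar>sin ((t - \<theta>) / 2)\<bar> \<le> h"
    by (auto simp: circ_arc_def cmod_cis_diff)
  define s where "s = \<bar>t - \<theta>\<bar> / 2"
  have s: "0 \<le> s" "s \<le> pi" using t assms by (auto simp: s_def)
  have "\<bar>sin ((t - \<theta>) / 2)\<bar> = \<bar>sin s\<bar>"
  proof -
    have "s = (t - \<theta>) / 2 \<or> s = - ((t - \<theta>) / 2)"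
      by (cases "t \<ge> \<theta>") (simp_all add: s_def field_simps)
    then show ?thesis by (elim disjE) (simp_all only: sin_minus abs_minus_cancel)
  qed
  with le have sh: "2 * sin s \<le> h" by linarith
  show "t \<in> {\<theta> - 2*h..\<theta> + 2*h} \<union> {0..2*h} \<union> {2*pi - 2*h..2*pi}"
  proof (cases "s \<le> pi/2")
    case True
    then have "s \<le> h" using sin_ge_half[of s] s sh by simp
    then show ?thesis by (auto simp: s_def)
  next
    case False
    then have "(pi - s) / 2 \<le> sin (pi - s)" using s by (intro sin_ge_half) auto
    then have "pi - s \<le> h" using sh by simp
    then have "2*pi - 2*h \<le> \<bar>t - \<theta>\<bar>" by (simp add: s_def)
    then have "2*pi - 2*h \<le> t \<or> t \<le> 2*h" using t assms by auto
    then show ?thesis using t by auto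
  qed
qed

lemma circ_arc_lmeasurable [simp]: "circ_arc \<theta> h \<in> lmeasurable"
proof (rule lmeasurable_compact)
  have "circ_arc \<theta> h = {0..2*pi} \<inter> {t. cmod (cis t - cis \<theta>) \<le> h}"
    by (auto simp: circ_arc_def)
  also have "compact \<dots>"
    by (intro compact_Int_closed closed_Collect_le continuous_intros) auto
  finally show "compact (circ_arc \<theta> h)" .
qed

lemma circ_arc_sets [measurable]: "circ_arc \<theta> h \<in> sets circ"
  using circ_arc_lmeasurable[of \<theta> h] fmeasurableD
  by (subst sets_restrict_space_iff) (auto simp: circ_arc_def)

lemma measure_circ_arc:
  assumes "\<theta> \<in> {0..2*pi}" "h > 0"
  shows "measure lebesgue (circ_arc \<theta> h) \<le> 8 * h"
proof -
  have lm: "{a..b::real} \<in> lmeasurable" for a b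
    by (rule lmeasurable_compact) simp
  have "measure lebesgue (circ_arc \<theta> h)
      \<le> measure lebesgue ({\<theta> - 2*h..\<theta> + 2*h} \<union> {0..2*h} \<union> {2*pi - 2*h..2*pi})"
    by (intro measure_mono_fmeasurable circ_arc_subset assms fmeasurableD circ_arc_lmeasurable fmeasurable.Un lm)
  also have "\<dots> \<le> measure lebesgue ({\<theta> - 2*h..\<theta> + 2*h} \<union> {0..2*h}) + measure lebesgue {2*pi - 2*h..2*pi}"
    by (intro measure_Un_le) auto
  also have "\<dots> \<le> measure lebesgue {\<theta> - 2*h..\<theta> + 2*h} + measure lebesgue {0..2*h} + measure lebesgue {2*pi - 2*h..2*pi}"
    by (intro add_mono measure_Un_le) auto
  also have "\<dots> = 8 * h" using assms by simp
  finally show ?thesis .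
qed

lemma integrable_mult_arc:
  fixes u :: "real \<Rightarrow> real"
  assumes "integrable circ u"
  shows "integrable circ (\<lambda>t. u t * indicator (circ_arc \<theta> h) t)"
  using integrable_real_mult_indicator[OF circ_arc_sets assms] by simp

text \<open>
  The weak type \<open>(1,1)\<close> inequality for the Hardy-Littlewood maximal function on the circle. Vitali's lemma,
  applied to discs in the plane centred on the circle, selects disjoint arcs on which the average exceeds \<open>c\<close>
  and whose fivefold enlargements cover the exceptional set. Disjointness bounds the sum of the radii by the
  integral. The constant is \<open>40 = 5 \<cdot> 8\<close>, with \<open>8\<close> from \<open>measure_circ_arc\<close>. The conclusion is about a
  measurable superset because null sets will be recognised by their outer measure.
\<close>

lemma maximal_inequality:
  fixes u :: "real \<Rightarrow> real"
  assumes u: "integrable circ u" "\<And>t. u t \<ge> 0" and "c > 0"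
  obtains T where "T \<in> lmeasurable"
    "{\<theta> \<in> {0..2*pi}. \<exists>h>0. (LINT t|circ. u t * indicator (circ_arc \<theta> h) t) > c * h} \<subseteq> T"
    "measure lebesgue T \<le> 40 / c * (LINT t|circ. u t)"
proof -
  define J where "J \<theta> h = (LINT t|circ. u t * indicator (circ_arc \<theta> h) t)" for \<theta> h
  define K where "K = {(\<theta>, h). \<theta> \<in> {0..2*pi} \<and> h > 0 \<and> J \<theta> h > c * h}"
  define S where "S = (\<lambda>(\<theta>, h::real). cis \<theta>) ` K"
  have J_le: "J \<theta> h \<le> (LINT t|circ. u t)" for \<theta> h
    unfolding J_def using u
    by (intro integral_mono integrable_mult_arc) (auto simp: indicator_def)
  \<comment> \<open>the radii are bounded, as the covering lemma requires, because no arc carries more than the whole integral\<close>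
  have rad: "0 < snd i \<and> snd i \<le> (LINT t|circ. u t) / c" if "i \<in> K" for i
    using that J_le[of "fst i" "snd i"] \<open>c > 0\<close> by (auto simp: K_def field_simps)
  have "S \<subseteq> (\<Union>i\<in>K. cball (cis (fst i)) (snd i))"
    using rad by (force simp: S_def)
  then obtain C where C: "countable C" "C \<subseteq> K"
     and pw: "pairwise (\<lambda>i j. disjnt (cball (cis (fst i)) (snd i)) (cball (cis (fst j)) (snd j))) C"
     and cover: "S \<subseteq> (\<Union>i\<in>C. cball (cis (fst i)) (5 * snd i))"
    using rad by (rule Vitali_covering_lemma_cballs[where a = "\<lambda>i. cis (fst i)" and r = snd])
  define T where "T = (\<Union>i\<in>C. circ_arc (fst i) (5 * snd i))"
  have disj: "disjoint_family_on (\<lambda>i. circ_arc (fst i) (snd i)) C"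
    unfolding disjoint_family_on_def
  proof (intro ballI impI)
    fix i j assume "i \<in> C" "j \<in> C" "i \<noteq> j"
    with pw have "cball (cis (fst i)) (snd i) \<inter> cball (cis (fst j)) (snd j) = {}"
      by (auto simp: pairwise_def disjnt_def)
    moreover have "cis t \<in> cball (cis (fst i)) (snd i)" if "t \<in> circ_arc (fst i) (snd i)" for t and i :: "real \<times> real"
      using that by (simp add: circ_arc_def dist_norm norm_minus_commute)
    ultimately show "circ_arc (fst i) (snd i) \<inter> circ_arc (fst j) (snd j) = {}" by blast
  qed
  have fin: "measure lebesgue (\<Union>i\<in>I. circ_arc (fst i) (5 * snd i)) \<le> 40 / c * (LINT t|circ. u t)"
    if I: "I \<subseteq> C" "finite I" for I
  proof -
    have IK: "fst i \<in> {0..2*pi}" "snd i > 0" "c * snd i \<le> J (fst i) (snd i)" if "i \<in> I" for i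
      using that I C by (auto simp: K_def)
    have "measure lebesgue (\<Union>i\<in>I. circ_arc (fst i) (5 * snd i))
        \<le> (\<Sum>i\<in>I. measure lebesgue (circ_arc (fst i) (5 * snd i)))"
      by (intro measure_UNION_le I) (simp add: fmeasurableD)
    also have "\<dots> \<le> (\<Sum>i\<in>I. 40 / c * J (fst i) (snd i))"
    proof (rule sum_mono)
      fix i assume "i \<in> I"
      then have "measure lebesgue (circ_arc (fst i) (5 * snd i)) \<le> 8 * (5 * snd i)"
        using IK by (intro measure_circ_arc) auto
      also have "\<dots> \<le> 40 / c * J (fst i) (snd i)"
        using IK(3)[OF \<open>i \<in> I\<close>] \<open>c > 0\<close> by (simp add: field_simps)
      finally show "measure lebesgue (circ_arc (fst i) (5 * snd i)) \<le> 40 / c * J (fst i) (snd i)" .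
    qed
    also have "\<dots> = 40 / c * (LINT t|circ. (\<Sum>i\<in>I. u t * indicator (circ_arc (fst i) (snd i)) t))"
      unfolding J_def by (simp add: Bochner_Integration.integral_sum integrable_mult_arc u(1) sum_distrib_left)
    also have "\<dots> = 40 / c * (LINT t|circ. u t * indicator (\<Union>i\<in>I. circ_arc (fst i) (snd i)) t)"
    proof -
      have "(\<Sum>i\<in>I. indicator (circ_arc (fst i) (snd i)) t)
          = (indicator (\<Union>i\<in>I. circ_arc (fst i) (snd i)) t :: real)" for t
        by (rule indicator_UN_disjoint[OF \<open>finite I\<close> disjoint_family_on_mono[OF \<open>I \<subseteq> C\<close> disj], symmetric])
      then show ?thesis by (simp flip: sum_distrib_left)
    qed
    also have "\<dots> \<le> 40 / c * (LINT t|circ. u t)"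
    proof (intro mult_left_mono integral_mono u(1))
      show "integrable circ (\<lambda>t. u t * indicator (\<Union>i\<in>I. circ_arc (fst i) (snd i)) t)"
        using I(2) by (intro integrable_real_mult_indicator u(1)) auto
    qed (use u(2) \<open>c > 0\<close> in \<open>auto simp: indicator_def\<close>)
    finally show ?thesis .
  qed
  show ?thesis
  proof
    show "T \<in> lmeasurable" unfolding T_def
      by (rule fmeasurable_UN_bound[OF C(1) _ fin]) auto
    show "measure lebesgue T \<le> 40 / c * (LINT t|circ. u t)" unfolding T_def
      by (rule measure_UN_bound[OF C(1) _ fin]) auto
    show "{\<theta> \<in> {0..2*pi}. \<exists>h>0. (LINT t|circ. u t * indicator (circ_arc \<theta> h) t) > c * h} \<subseteq> T"
    proof safe
      fix \<theta> h :: real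
      assume *: "\<theta> \<in> {0..2*pi}" "h > 0" "(LINT t|circ. u t * indicator (circ_arc \<theta> h) t) > c * h"
      then have "(\<theta>, h) \<in> K" by (simp add: K_def J_def)
      then have "cis \<theta> \<in> S" by (force simp: S_def)
      with cover * show "\<theta> \<in> T"
        by (force simp: T_def circ_arc_def dist_norm norm_minus_commute)
    qed
  qed
qed

text \<open>
  In a Stolz region with vertex \<open>cis \<theta>\<close> the distance from \<open>cis t\<close> to \<open>z\<close> is comparable to the maximum of \<open>1 - \<bar>z\<bar>\<close> and the distance
  to the vertex. So the Poisson kernel is dominated by indicators of the arcs of radius \<open>2\<^sup>k R\<close> around the vertex
  with weights proportional to \<open>4\<^sup>-\<^sup>k\<close>; each arc contributes at most its average bound, and the
  resulting geometric series converges.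
\<close>

lemma Poisson_kernel_bound:
  fixes u :: "real \<Rightarrow> real"
  assumes u: "integrable circ u" "\<And>t. u t \<ge> 0" and "c \<ge> 0" and "\<alpha> > 1"
    and avg: "\<And>h. h > 0 \<Longrightarrow> (LINT t|circ. u t * indicator (circ_arc \<theta> h) t) \<le> c * h"
    and z: "z \<in> stolz \<alpha> (cis \<theta>)"
  shows "(LINT t|circ. u t * ((1 - (cmod z)\<^sup>2) / (cmod (cis t - z))\<^sup>2)) \<le> 16 * (1 + \<alpha>) * c"
proof -
  define \<delta> where "\<delta> = 1 - cmod z"
  define R where "R = (1 + \<alpha>) * \<delta>"
  have \<delta>: "0 < \<delta>" and zd: "cmod (z - cis \<theta>) < \<alpha> * \<delta>"
    using z by (auto simp: stolz_def \<delta>_def)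
  then have R: "R > 0" using \<open>\<alpha> > 1\<close> by (simp add: R_def)
  \<comment> \<open>the circle has diameter \<open>2\<close>, so the arc of radius \<open>2\<^sup>K R\<close> is all of it\<close>
  obtain K where K: "2 / R < 2 ^ K"
    using real_arch_pow[of 2 "2 / R"] by auto
  define W where "W t = (\<Sum>k\<le>K. 4 * (1/4)^k / \<delta>\<^sup>2 * indicator (circ_arc \<theta> (2^k * R)) t)" for t
  have kernel: "1 / (cmod (cis t - z))\<^sup>2 \<le> W t" if t: "t \<in> {0..2*pi}" for t
  proof -
    define d where "d = cmod (cis t - cis \<theta>)"
    define D where "D = cmod (cis t - z)"
    have D: "\<delta> \<le> D"
      using norm_triangle_ineq2[of "cis t" z] by (simp add: D_def \<delta>_def)
    have "d \<le> D + cmod (z - cis \<theta>)"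
      unfolding d_def D_def using norm_triangle_ineq[of "cis t - z" "z - cis \<theta>"] by simp
    also have "\<dots> \<le> D + \<alpha> * D"
      using zd mult_left_mono[OF D, of \<alpha>] \<open>\<alpha> > 1\<close> by linarith
    finally have dD: "d \<le> (1 + \<alpha>) * D" by (simp add: algebra_simps)
    have "d \<le> 2"
      unfolding d_def using norm_triangle_ineq4[of "cis t" "cis \<theta>"] by simp
    then have dK: "d \<le> 2 ^ K * R"
      using K R by (simp add: field_simps)
    \<comment> \<open>the first dyadic arc that contains the point; its term alone dominates the kernel\<close>
    define k where "k = (LEAST k. d \<le> 2 ^ k * R)"
    have dk: "d \<le> 2 ^ k * R" unfolding k_def by (rule LeastI[where P = "\<lambda>k. d \<le> 2 ^ k * R", OF dK])
    have "k \<le> K" unfolding k_def by (rule Least_le[where P = "\<lambda>k. d \<le> 2 ^ k * R", OF dK])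
    have "1 / D\<^sup>2 \<le> 4 * (1/4)^k / \<delta>\<^sup>2"
    proof (cases k)
      case 0
      have "1 / D\<^sup>2 \<le> 1 / \<delta>\<^sup>2"
        using D \<delta> by (intro divide_left_mono power_mono) auto
      also have "\<dots> \<le> 4 / \<delta>\<^sup>2"
        by (intro divide_right_mono) auto
      finally show ?thesis using 0 by simp
    next
      case (Suc j)
      have "\<not> d \<le> 2 ^ j * R"
        using not_less_Least[of j "\<lambda>k. d \<le> 2 ^ k * R"] Suc unfolding k_def by simp
      then have "(1 + \<alpha>) * (2 ^ j * \<delta>) < (1 + \<alpha>) * D"
        using dD by (simp add: R_def mult_ac)
      then have jD: "2 ^ j * \<delta> < D"
        using \<open>\<alpha> > 1\<close> by simp
      have "0 < 2 ^ j * \<delta>" using \<delta> by simp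
      with jD have "1 / D\<^sup>2 \<le> 1 / (2 ^ j * \<delta>)\<^sup>2"
        using \<delta> by (intro divide_left_mono power_mono mult_pos_pos zero_less_power) linarith+
      also have "\<dots> = 4 * (1/4)^k / \<delta>\<^sup>2"
        by (simp add: Suc power_mult_distrib power_divide power2_eq_square flip: power_mult_distrib)
      finally show ?thesis .
    qed
    also have "\<dots> = 4 * (1/4)^k / \<delta>\<^sup>2 * indicator (circ_arc \<theta> (2^k * R)) t"
      using t dk by (simp add: circ_arc_def d_def)
    also have "\<dots> \<le> W t"
      unfolding W_def using \<open>k \<le> K\<close>
      by (intro member_le_sum[of k "{..K}" "\<lambda>k. 4 * (1/4)^k / \<delta>\<^sup>2 * indicator (circ_arc \<theta> (2^k * R)) t"]) auto
    finally show ?thesis by (simp add: D_def)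
  qed
  have sq: "0 \<le> 1 - (cmod z)\<^sup>2" "1 - (cmod z)\<^sup>2 \<le> 2 * \<delta>"
  proof -
    have "1 - (cmod z)\<^sup>2 = \<delta> * (1 + cmod z)"
      by (simp add: \<delta>_def power2_eq_square algebra_simps)
    moreover have "1 + cmod z \<le> 2" using \<delta> by (simp add: \<delta>_def)
    then have "\<delta> * (1 + cmod z) \<le> \<delta> * 2" using \<delta> by (intro mult_left_mono) auto
    moreover have "0 \<le> \<delta> * (1 + cmod z)" using \<delta> by simp
    ultimately show "0 \<le> 1 - (cmod z)\<^sup>2" "1 - (cmod z)\<^sup>2 \<le> 2 * \<delta>" by linarith+
  qed
  have eqW: "u t * (2 * \<delta> * W t)
      = (\<Sum>k\<le>K. 8 * (1/4)^k / \<delta> * (u t * indicator (circ_arc \<theta> (2^k * R)) t))" for t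
    unfolding W_def sum_distrib_left using \<delta>
    by (intro sum.cong) (auto simp: field_simps power2_eq_square)
  have intW: "integrable circ (\<lambda>t. u t * (2 * \<delta> * W t))"
    unfolding eqW using integrable_mult_arc[OF u(1)]
    by (intro Bochner_Integration.integrable_sum integrable_mult_right) auto
  have "(LINT t|circ. u t * ((1 - (cmod z)\<^sup>2) / (cmod (cis t - z))\<^sup>2)) \<le> (LINT t|circ. u t * (2 * \<delta> * W t))"
  proof (rule integral_mono_AE')
    show "AE t in circ. u t * ((1 - (cmod z)\<^sup>2) / (cmod (cis t - z))\<^sup>2) \<le> u t * (2 * \<delta> * W t)"
    proof (rule AE_I2)
      fix t assume "t \<in> space circ"
      then have t: "t \<in> {0..2*pi}" by simp
      have "(1 - (cmod z)\<^sup>2) * (1 / (cmod (cis t - z))\<^sup>2) \<le> 2 * \<delta> * W t"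
        by (intro mult_mono sq kernel t) (use \<delta> in auto)
      then show "u t * ((1 - (cmod z)\<^sup>2) / (cmod (cis t - z))\<^sup>2) \<le> u t * (2 * \<delta> * W t)"
        using u(2)[of t] by (intro mult_left_mono) auto
    qed
    show "AE t in circ. 0 \<le> u t * (2 * \<delta> * W t)"
      using \<delta> u(2) unfolding W_def by (intro AE_I2 mult_nonneg_nonneg sum_nonneg) auto
  qed (rule intW)
  also have "\<dots> = (LINT t|circ. (\<Sum>k\<le>K. 8 * (1/4)^k / \<delta> * (u t * indicator (circ_arc \<theta> (2^k * R)) t)))"
    by (simp only: eqW)
  also have "\<dots> = (\<Sum>k\<le>K. 8 * (1/4)^k / \<delta> * (LINT t|circ. u t * indicator (circ_arc \<theta> (2^k * R)) t))"
    by (subst Bochner_Integration.integral_sum)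
      (auto simp del: times_divide_eq_left intro!: integrable_mult_right integrable_mult_arc u(1))
  also have "\<dots> \<le> (\<Sum>k\<le>K. 8 * (1/4)^k / \<delta> * (c * (2^k * R)))"
    by (intro sum_mono mult_left_mono avg) (use R \<delta> in auto)
  also have "\<dots> = 8 * (1 + \<alpha>) * c * (\<Sum>k\<le>K. (1/2)^k)"
  proof -
    have "(1/4)^k * 2^k = (1/2::real)^k" for k
      by (simp flip: power_mult_distrib)
    then have "8 * (1/4)^k / \<delta> * (c * (2^k * R)) = 8 * (1 + \<alpha>) * c * (1/2)^k" for k
      using \<delta> by (simp add: R_def mult_ac)
    then show ?thesis by (simp add: sum_distrib_left)
  qed
  also have "\<dots> \<le> 8 * (1 + \<alpha>) * c * 2"
  proof (rule mult_left_mono)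
    show "(\<Sum>k\<le>K. (1/2::real)^k) \<le> 2"
      using sum_le_suminf[of "\<lambda>k. (1/2::real)^k" "{..K}"] suminf_geometric[of "1/2::real"]
      by (simp add: summable_geometric)
  qed (use \<open>\<alpha> > 1\<close> \<open>c \<ge> 0\<close> in simp)
  finally show ?thesis by (simp add: mult_ac)
qed

text \<open>
  If the averages of \<open>\<bar>f\<bar>\<^sup>2\<close> over all arcs around \<open>cis \<theta>\<close> are at most \<open>c\<close>, the two Poisson estimates give
  \<open>2 \<pi> \<bar>f z\<bar>\<^sup>2 \<le> 16 (1 + \<alpha>) c\<close> throughout the Stolz region. The maximal inequality is used at the value of \<open>c\<close> for which
  this says \<open>\<bar>f z\<bar> \<le> \<epsilon>\<close>.
\<close>

lemma nontangential_weak_type: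
  assumes cont: "continuous_on (cball 0 1) f" and hol: "f holomorphic_on ball 0 1"
    and "\<alpha> > 1" "\<epsilon> > 0"
  obtains T where "T \<in> lmeasurable"
    "{\<theta> \<in> {0..2*pi}. \<exists>z\<in>stolz \<alpha> (cis \<theta>). cmod (f z) > \<epsilon>} \<subseteq> T"
    "measure lebesgue T \<le> 640 * (1 + \<alpha>) / \<epsilon>\<^sup>2 * L2_normsq f"
proof -
  \<comment> \<open>chosen so that \<open>16 (1 + \<alpha>) c = 2 \<pi> \<epsilon>\<^sup>2\<close>\<close>
  define c where "c = 2 * pi * \<epsilon>\<^sup>2 / (16 * (1 + \<alpha>))"
  define u where "u t = (cmod (f (cis t)))\<^sup>2" for t
  have "c > 0" using \<open>\<alpha> > 1\<close> \<open>\<epsilon> > 0\<close> by (simp add: c_def)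
  have u: "integrable circ u" "\<And>t. u t \<ge> 0"
  proof -
    have "f \<in> L2_circle"
      by (intro L2_circle_continuous continuous_on_subset[OF cont]) auto
    then show "integrable circ u" unfolding u_def by (rule L2_circle_integrable)
  qed (simp add: u_def)
  obtain T where T: "T \<in> lmeasurable"
    "{\<theta> \<in> {0..2*pi}. \<exists>h>0. (LINT t|circ. u t * indicator (circ_arc \<theta> h) t) > c * h} \<subseteq> T"
    "measure lebesgue T \<le> 40 / c * (LINT t|circ. u t)"
    using maximal_inequality[OF u \<open>c > 0\<close>] by blast
  show ?thesis
  proof
    show "T \<in> lmeasurable" by fact
    show "{\<theta> \<in> {0..2*pi}. \<exists>z\<in>stolz \<alpha> (cis \<theta>). cmod (f z) > \<epsilon>} \<subseteq> T"
    proof safe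
      fix \<theta> z assume \<theta>: "\<theta> \<in> {0..2*pi}" and z: "z \<in> stolz \<alpha> (cis \<theta>)" and big: "cmod (f z) > \<epsilon>"
      show "\<theta> \<in> T"
      proof (rule ccontr)
        assume "\<theta> \<notin> T"
        with T(2) \<theta> have avg: "(LINT t|circ. u t * indicator (circ_arc \<theta> h) t) \<le> c * h" if "h > 0" for h
          using that by (force simp: not_less)
        have "2 * pi * (cmod (f z))\<^sup>2 \<le> (LINT t|circ. u t * ((1 - (cmod z)\<^sup>2) / (cmod (cis t - z))\<^sup>2))"
          unfolding u_def using z by (intro Poisson_bound_normsq cont hol) (simp add: stolz_def)
        also have "\<dots> \<le> 16 * (1 + \<alpha>) * c"
          using \<open>c > 0\<close> by (intro Poisson_kernel_bound[OF u _ \<open>\<alpha> > 1\<close> avg z]) auto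
        also have "\<dots> = 2 * pi * \<epsilon>\<^sup>2"
          using \<open>\<alpha> > 1\<close> by (simp add: c_def)
        finally have "(cmod (f z))\<^sup>2 \<le> \<epsilon>\<^sup>2" by simp
        then have "cmod (f z) \<le> \<epsilon>" by (rule power2_le_imp_le) (use \<open>\<epsilon> > 0\<close> in simp)
        with big show False by simp
      qed
    qed
    have "(LINT t|circ. u t) = 2 * pi * L2_normsq f"
      by (simp add: L2_normsq_def u_def)
    then have "40 / c * (LINT t|circ. u t) = 640 * (1 + \<alpha>) / \<epsilon>\<^sup>2 * L2_normsq f"
      using \<open>\<alpha> > 1\<close> \<open>\<epsilon> > 0\<close> by (simp add: c_def)
    with T(3) show "measure lebesgue T \<le> 640 * (1 + \<alpha>) / \<epsilon>\<^sup>2 * L2_normsq f"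
      by linarith
  qed
qed

section \<open>Hardy functions as square-summable power series\<close>

definition h2_series :: "(nat \<Rightarrow> complex) \<Rightarrow> (complex \<Rightarrow> complex) \<Rightarrow> bool" where
  "h2_series a f \<longleftrightarrow>
     summable (\<lambda>k. (cmod (a k))\<^sup>2) \<and> (\<forall>z\<in>disk. (\<lambda>k. a k * z ^ k) sums f z)"

definition radius_seq :: "nat \<Rightarrow> real" where
  "radius_seq m = 1 - inverse (real (Suc m))"

lemma radius_seq: "0 \<le> radius_seq m" "radius_seq m < 1"
  by (auto simp: radius_seq_def field_simps)

lemma radius_seq_tendsto: "radius_seq \<longlonglongrightarrow> 1"
  unfolding radius_seq_def using tendsto_diff[OF tendsto_const LIMSEQ_inverse_real_of_nat, of 1] by simp

lemma circle_mean_eq: "circle_mean f r = L2_normsq (\<lambda>\<zeta>. f (of_real r * \<zeta>))"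
  by (simp add: circle_mean_def L2_normsq_def)

text \<open>
  Parseval's identity for polynomials passes to the limit by dominated convergence, because the series
  converges absolutely and uniformly on the circle of radius \<open>r < 1\<close>.
\<close>

lemma circle_mean_power_series:
  assumes f: "\<forall>z\<in>disk. (\<lambda>k. a k * z ^ k) sums f z" and r: "0 \<le> r" "r < 1"
  shows "(\<lambda>k. (cmod (a k))\<^sup>2 * r ^ (2 * k)) sums circle_mean f r"
proof -
  define p where "p n \<theta> = (\<Sum>k<n. (a k * of_real r ^ k) * cis \<theta> ^ k)" for n \<theta>
  have "summable (\<lambda>k. norm (a k * (of_real r) ^ k))"
  proof (rule powser_insidea)
    show "summable (\<lambda>k. a k * of_real ((r + 1) / 2) ^ k)"
      using f r by (intro sums_summable[of _ "f (of_real ((r + 1) / 2))"]) (auto simp del: of_real_divide of_real_add)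
    show "norm (complex_of_real r) < norm (complex_of_real ((r + 1) / 2))"
      using r by (simp del: of_real_divide of_real_add)
  qed
  then have summ: "summable (\<lambda>k. cmod (a k) * r ^ k)"
    using r by (simp add: norm_mult norm_power)
  define B where "B = (\<Sum>k. cmod (a k) * r ^ k)"
  have bound: "cmod (p n \<theta>) \<le> B" for n \<theta>
  proof -
    have "cmod (p n \<theta>) \<le> (\<Sum>k<n. cmod (a k) * r ^ k)"
      unfolding p_def by (rule order_trans[OF norm_sum]) (use r in \<open>simp add: norm_mult norm_power\<close>)
    also have "\<dots> \<le> B" unfolding B_def
      using summ r by (intro sum_le_suminf) auto
    finally show ?thesis .
  qed
  have lim: "(\<lambda>n. p n \<theta>) \<longlonglongrightarrow> f (of_real r * cis \<theta>)" for \<theta>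
  proof -
    have "of_real r * cis \<theta> \<in> disk" using r by (simp add: norm_mult)
    with f have "(\<lambda>k. a k * (of_real r * cis \<theta>) ^ k) sums f (of_real r * cis \<theta>)" by blast
    then show ?thesis by (simp add: sums_def p_def power_mult_distrib mult.assoc)
  qed
  have meas: "p n \<in> borel_measurable circ" for n
    using L2_circle_measurable[OF L2_circle_polynomial[of "\<lambda>k. a k * of_real r ^ k" "{..<n}"]]
    by (simp add: circle_measurable_def p_def[abs_def])
  have "(\<lambda>n. LINT \<theta>|circ. (cmod (p n \<theta>))\<^sup>2) \<longlonglongrightarrow> (LINT \<theta>|circ. (cmod (f (of_real r * cis \<theta>)))\<^sup>2)"
  proof (rule integral_dominated_convergence[where w = "\<lambda>_. B\<^sup>2"])
    have "(\<lambda>\<theta>. f (of_real r * cis \<theta>)) \<in> borel_measurable circ"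
      by (rule borel_measurable_LIMSEQ_metric[OF meas lim])
    then show "(\<lambda>\<theta>. (cmod (f (of_real r * cis \<theta>)))\<^sup>2) \<in> borel_measurable circ"
      by measurable
    show "(\<lambda>\<theta>. (cmod (p n \<theta>))\<^sup>2) \<in> borel_measurable circ" for n
      using meas[of n] by measurable
    show "integrable circ (\<lambda>_. B\<^sup>2)"
      by (intro integrable_circ_continuous continuous_intros)
    show "AE \<theta> in circ. (\<lambda>n. (cmod (p n \<theta>))\<^sup>2) \<longlonglongrightarrow> (cmod (f (of_real r * cis \<theta>)))\<^sup>2"
      by (intro AE_I2 tendsto_intros lim)
    show "AE \<theta> in circ. norm ((cmod (p n \<theta>))\<^sup>2) \<le> B\<^sup>2" for n
      using bound by (auto intro!: AE_I2 power_mono)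
  qed
  then have "(\<lambda>n. (LINT \<theta>|circ. (cmod (p n \<theta>))\<^sup>2) / (2*pi)) \<longlonglongrightarrow> circle_mean f r"
    unfolding circle_mean_def by (intro tendsto_intros) auto
  moreover have "(LINT \<theta>|circ. (cmod (p n \<theta>))\<^sup>2) / (2*pi) = (\<Sum>k<n. (cmod (a k))\<^sup>2 * r ^ (2 * k))" for n
  proof -
    have "(LINT \<theta>|circ. (cmod (p n \<theta>))\<^sup>2) / (2*pi) = (\<Sum>k<n. (cmod (a k * of_real r ^ k))\<^sup>2)"
      using L2_normsq_polynomial[of "{..<n}" "\<lambda>k. a k * of_real r ^ k"]
      by (simp add: L2_normsq_def p_def)
    also have "\<dots> = (\<Sum>k<n. (cmod (a k))\<^sup>2 * r ^ (2 * k))"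
      using r by (simp add: norm_mult norm_power power_mult_distrib mult.commute flip: power_mult)
    finally show ?thesis .
  qed
  ultimately show ?thesis by (simp add: sums_def)
qed

lemma circle_mean_le_suminf:
  assumes f: "h2_series a f" and r: "0 \<le> r" "r < 1"
  shows "circle_mean f r \<le> (\<Sum>k. (cmod (a k))\<^sup>2)"
proof -
  have s: "(\<lambda>k. (cmod (a k))\<^sup>2 * r ^ (2 * k)) sums circle_mean f r"
    using f r by (intro circle_mean_power_series) (auto simp: h2_series_def)
  have "circle_mean f r = (\<Sum>k. (cmod (a k))\<^sup>2 * r ^ (2 * k))"
    using s by (rule sums_unique)
  also have "\<dots> \<le> (\<Sum>k. (cmod (a k))\<^sup>2)"
    using f r s by (intro suminf_le) (auto simp: h2_series_def sums_iff power_le_one intro!: mult_left_le)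
  finally show ?thesis .
qed

lemma partial_sum_le_circle_mean_bound:
  assumes f: "\<forall>z\<in>disk. (\<lambda>k. a k * z ^ k) sums f z"
    and B: "\<And>r. 0 \<le> r \<Longrightarrow> r < 1 \<Longrightarrow> circle_mean f r \<le> B"
  shows "(\<Sum>k<n. (cmod (a k))\<^sup>2) \<le> B"
proof (rule tendsto_upperbound)
  have "(\<lambda>m. \<Sum>k<n. (cmod (a k))\<^sup>2 * radius_seq m ^ (2 * k)) \<longlonglongrightarrow> (\<Sum>k<n. (cmod (a k))\<^sup>2 * 1 ^ (2 * k))"
    by (intro tendsto_intros radius_seq_tendsto)
  then show "(\<lambda>m. \<Sum>k<n. (cmod (a k))\<^sup>2 * radius_seq m ^ (2 * k)) \<longlonglongrightarrow> (\<Sum>k<n. (cmod (a k))\<^sup>2)"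
    by simp
  show "\<forall>\<^sub>F m in sequentially. (\<Sum>k<n. (cmod (a k))\<^sup>2 * radius_seq m ^ (2 * k)) \<le> B"
  proof (intro always_eventually allI)
    fix m
    have s: "(\<lambda>k. (cmod (a k))\<^sup>2 * radius_seq m ^ (2 * k)) sums circle_mean f (radius_seq m)"
      by (intro circle_mean_power_series f radius_seq)
    have "(\<Sum>k<n. (cmod (a k))\<^sup>2 * radius_seq m ^ (2 * k)) \<le> circle_mean f (radius_seq m)"
      using s radius_seq(1) by (subst sums_unique[OF s], intro sum_le_suminf) (auto simp: sums_iff)
    also have "\<dots> \<le> B" by (intro B radius_seq)
    finally show "(\<Sum>k<n. (cmod (a k))\<^sup>2 * radius_seq m ^ (2 * k)) \<le> B" .
  qed
qed simp

lemma H2_imp_h2_series: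
  assumes "f \<in> H2"
  obtains a where "h2_series a f"
proof
  define a where "a k = (deriv ^^ k) f 0 / fact k" for k
  have hol: "f holomorphic_on disk" and bdd: "bdd_above (circle_mean f ` {0..<1})"
    using assms by (auto simp: H2_def)
  have series: "\<forall>z\<in>disk. (\<lambda>k. a k * z ^ k) sums f z"
    using holomorphic_power_series[OF hol] by (simp add: a_def)
  obtain B where B: "\<And>r. 0 \<le> r \<Longrightarrow> r < 1 \<Longrightarrow> circle_mean f r \<le> B"
    using bdd unfolding bdd_above_def by (metis atLeastLessThan_iff imageI)
  have "summable (\<lambda>k. (cmod (a k))\<^sup>2)"
    by (rule summableI_nonneg_bounded[OF _ partial_sum_le_circle_mean_bound[OF series B]]) auto
  with series show "h2_series a f" by (simp add: h2_series_def)
qed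

lemma h2_series_imp_H2:
  assumes "h2_series a f" "f \<in> extensional disk"
  shows "f \<in> H2"
proof -
  have "f holomorphic_on disk"
    using assms(1) by (intro power_series_holomorphic[of 0 1 a]) (auto simp: h2_series_def)
  moreover have "bdd_above (circle_mean f ` {0..<1})"
    using circle_mean_le_suminf[OF assms(1)] by (intro bdd_aboveI2) auto
  ultimately show ?thesis using assms(2) by (simp add: H2_def)
qed

text \<open>
  The means are \<open>\<Sum>\<^sub>k \<bar>a\<^sub>k\<bar>\<^sup>2 r\<^sup>2\<^sup>k\<close>; letting \<open>r\<close> tend to \<open>1\<close> in each partial sum shows that their supremum is the full sum.
\<close>

lemma H2_norm_eq_coeff_norm:
  assumes f: "h2_series a f"
  shows "(H2_norm f)\<^sup>2 = (\<Sum>k. (cmod (a k))\<^sup>2)"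
proof -
  have "(SUP r\<in>{0..<1}. circle_mean f r) = (\<Sum>k. (cmod (a k))\<^sup>2)"
  proof (rule antisym)
    show "(SUP r\<in>{0..<1}. circle_mean f r) \<le> (\<Sum>k. (cmod (a k))\<^sup>2)"
      using circle_mean_le_suminf[OF f] by (intro cSUP_least) auto
    have "bdd_above (circle_mean f ` {0..<1})"
      using circle_mean_le_suminf[OF f] by (intro bdd_aboveI2) auto
    then have "circle_mean f r \<le> (SUP r\<in>{0..<1}. circle_mean f r)" if "0 \<le> r" "r < 1" for r
      using that by (intro cSUP_upper) auto
    then show "(\<Sum>k. (cmod (a k))\<^sup>2) \<le> (SUP r\<in>{0..<1}. circle_mean f r)"
      using f by (intro suminf_le_const partial_sum_le_circle_mean_bound) (auto simp: h2_series_def)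
  qed
  moreover have "0 \<le> (\<Sum>k. (cmod (a k))\<^sup>2)"
    using f by (intro suminf_nonneg) (auto simp: h2_series_def)
  ultimately show ?thesis by (simp add: H2_norm_def)
qed

lemma h2_series_add:
  assumes "h2_series a f" "h2_series b k"
  shows "h2_series (\<lambda>n. a n + b n) (\<lambda>z\<in>disk. f z + k z)"
proof -
  have "summable (\<lambda>n. 2 * (cmod (a n))\<^sup>2 + 2 * (cmod (b n))\<^sup>2)"
    using assms by (intro summable_add summable_mult) (auto simp: h2_series_def)
  then have "summable (\<lambda>n. (cmod (a n + b n))\<^sup>2)"
    by (rule summable_comparison_test'[where N = 0]) (simp add: cmod_add_square_le)
  moreover have "(\<lambda>n. (a n + b n) * z ^ n) sums (f z + k z)" if "z \<in> disk" for z
    using assms that by (auto simp: h2_series_def distrib_right intro!: sums_add)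
  ultimately show ?thesis by (auto simp: h2_series_def)
qed

lemma h2_series_cmult:
  assumes "h2_series a f"
  shows "h2_series (\<lambda>n. c * a n) (\<lambda>z\<in>disk. c * f z)"
proof -
  have "summable (\<lambda>n. (cmod c)\<^sup>2 * (cmod (a n))\<^sup>2)"
    using assms by (intro summable_mult) (simp add: h2_series_def)
  then have "summable (\<lambda>n. (cmod (c * a n))\<^sup>2)"
    by (simp add: norm_mult power_mult_distrib)
  moreover have "(\<lambda>n. c * a n * z ^ n) sums (c * f z)" if "z \<in> disk" for z
    unfolding mult.assoc using assms that by (intro sums_mult) (simp add: h2_series_def)
  ultimately show ?thesis by (auto simp: h2_series_def)
qed

lemma h2_series_tail:
  assumes "h2_series a f"
  shows "h2_series (\<lambda>k. if k < n then 0 else a k) (\<lambda>z. f z - (\<Sum>k<n. a k * z ^ k))"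
proof -
  have "(\<lambda>k. (if k < n then 0 else a k) * z ^ k) sums (f z - (\<Sum>k<n. a k * z ^ k))" if "z \<in> disk" for z
  proof -
    have "(\<lambda>k. a k * z ^ k) sums f z" using assms that by (simp add: h2_series_def)
    moreover have "(\<lambda>k. if k \<in> {..<n} then a k * z ^ k else 0) sums (\<Sum>k<n. a k * z ^ k)"
      by (rule sums_If_finite_set) simp
    ultimately have "(\<lambda>k. a k * z ^ k - (if k \<in> {..<n} then a k * z ^ k else 0)) sums (f z - (\<Sum>k<n. a k * z ^ k))"
      by (rule sums_diff)
    moreover have "(\<lambda>k. a k * z ^ k - (if k \<in> {..<n} then a k * z ^ k else 0))
        = (\<lambda>k. (if k < n then 0 else a k) * z ^ k)" by auto
    ultimately show ?thesis by simp
  qed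
  moreover have "summable (\<lambda>k. (cmod (if k < n then 0 else a k))\<^sup>2)"
    by (rule summable_comparison_test'[where N = 0 and g = "\<lambda>k. (cmod (a k))\<^sup>2"])
      (use assms in \<open>auto simp: h2_series_def\<close>)
  ultimately show ?thesis by (simp add: h2_series_def)
qed

definition tail_normsq :: "(nat \<Rightarrow> complex) \<Rightarrow> nat \<Rightarrow> real" where
  "tail_normsq a n = (\<Sum>k. (cmod (a (k + n)))\<^sup>2)"

lemma suminf_truncated:
  assumes "summable (\<lambda>k. (cmod (a k))\<^sup>2)"
  shows "(\<Sum>k. (cmod (if k < n then 0 else a k))\<^sup>2) = tail_normsq a n"
proof -
  have "summable (\<lambda>k. (cmod (if k < n then 0 else a k))\<^sup>2)"
    using assms by (rule summable_comparison_test'[where N = 0 and g = "\<lambda>k. (cmod (a k))\<^sup>2"]) auto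
  from suminf_split_initial_segment[OF this, of n] show ?thesis
    by (simp add: tail_normsq_def)
qed

lemma tail_normsq_tendsto_0:
  assumes "summable (\<lambda>k. (cmod (a k))\<^sup>2)"
  shows "tail_normsq a \<longlonglongrightarrow> 0"
  using suminf_exist_split2[OF assms] by (simp add: tail_normsq_def[abs_def])

lemma segment_le_tail_normsq:
  assumes "summable (\<lambda>k. (cmod (a k))\<^sup>2)"
  shows "(\<Sum>k\<in>{n..<m}. (cmod (a k))\<^sup>2) \<le> tail_normsq a n"
proof (cases "n \<le> m")
  case True
  have "(\<Sum>k\<in>{n..<m}. (cmod (a k))\<^sup>2) = (\<Sum>k<m - n. (cmod (a (k + n)))\<^sup>2)"
    using True sum.shift_bounds_nat_ivl[of "\<lambda>k. (cmod (a k))\<^sup>2" 0 n "m - n"]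
    by (simp add: lessThan_atLeast0)
  also have "\<dots> \<le> tail_normsq a n"
    unfolding tail_normsq_def using assms
    by (intro sum_le_suminf) (auto simp: summable_iff_shift[of "\<lambda>k. (cmod (a k))\<^sup>2"])
  finally show ?thesis .
next
  case False
  have "0 \<le> tail_normsq a n"
    unfolding tail_normsq_def using assms
    by (intro suminf_nonneg) (auto simp: summable_iff_shift[of "\<lambda>k. (cmod (a k))\<^sup>2"])
  with False show ?thesis by simp
qed

section \<open>Fatou's theorem on nontangential limits\<close>

lemma stolz_mono: "\<alpha> \<le> \<beta> \<Longrightarrow> stolz \<alpha> \<zeta> \<subseteq> stolz \<beta> \<zeta>"
  by (force simp: stolz_def intro: less_le_trans mult_right_mono)

lemma radial_in_stolz:
  assumes "cmod \<zeta> = 1" "\<alpha> > 1" "0 \<le> r" "r < 1"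
  shows "of_real r * \<zeta> \<in> stolz \<alpha> \<zeta>"
proof -
  have "of_real r * \<zeta> - \<zeta> = of_real (r - 1) * \<zeta>" by (simp add: algebra_simps)
  then have "cmod (of_real r * \<zeta> - \<zeta>) = 1 - r"
    using assms by (simp add: norm_mult del: of_real_diff)
  then show ?thesis
    using assms by (simp add: stolz_def norm_mult)
qed

lemma radial_filterlim_stolz:
  assumes "cmod \<zeta> = 1" "\<alpha> > 1"
  shows "filterlim (\<lambda>m. of_real (radius_seq m) * \<zeta>) (at \<zeta> within stolz \<alpha> \<zeta>) sequentially"
  unfolding filterlim_at
proof
  have "(\<lambda>m. of_real (radius_seq m) * \<zeta>) \<longlonglongrightarrow> of_real 1 * \<zeta>"
    by (intro tendsto_intros radius_seq_tendsto)
  then show "(\<lambda>m. of_real (radius_seq m) * \<zeta>) \<longlonglongrightarrow> \<zeta>" by simp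
  have "of_real (radius_seq m) * \<zeta> \<noteq> \<zeta>" for m
    using radius_seq[of m] assms(1) by (auto simp: norm_eq_zero[of \<zeta>, symmetric] simp del: norm_eq_zero)
  then show "\<forall>\<^sub>F m in sequentially. of_real (radius_seq m) * \<zeta> \<in> stolz \<alpha> \<zeta> \<and> of_real (radius_seq m) * \<zeta> \<noteq> \<zeta>"
    using radial_in_stolz[OF assms radius_seq] by simp
qed

text \<open>
  The radius ending at the vertex lies in the Stolz region, so the vertex is a limit point of the region and
  limits there are unique.
\<close>

lemma stolz_nontrivial:
  assumes "cmod \<zeta> = 1" "\<alpha> > 1"
  shows "at \<zeta> within stolz \<alpha> \<zeta> \<noteq> bot"
  using radial_filterlim_stolz[OF assms] by (auto simp: filterlim_def bot_unique filtermap_bot_iff)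

lemma bdry_eqI:
  assumes "cmod \<zeta> = 1" "has_nt_limit f \<zeta> l"
  shows "bdry f \<zeta> = l"
  unfolding bdry_def
proof (rule the_equality)
  fix l' assume "has_nt_limit f \<zeta> l'"
  with assms(2) have "(f \<longlongrightarrow> l') (at \<zeta> within stolz 2 \<zeta>)" "(f \<longlongrightarrow> l) (at \<zeta> within stolz 2 \<zeta>)"
    by (simp_all add: has_nt_limit_def)
  then show "l' = l" by (rule tendsto_unique[OF stolz_nontrivial[OF assms(1)], rotated]) simp
qed (rule assms)

lemma has_nt_limit_bdry:
  assumes "cmod \<zeta> = 1" "has_nt_limit f \<zeta> l"
  shows "has_nt_limit f \<zeta> (bdry f \<zeta>)"
  using assms bdry_eqI by metis

lemma nt_limit_radial:
  assumes "cmod \<zeta> = 1" "has_nt_limit f \<zeta> l"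
  shows "(\<lambda>m. f (of_real (radius_seq m) * \<zeta>)) \<longlonglongrightarrow> l"
proof -
  have "(f \<longlongrightarrow> l) (at \<zeta> within stolz 2 \<zeta>)"
    using assms(2) by (simp add: has_nt_limit_def)
  then show ?thesis
    by (rule filterlim_compose) (use radial_filterlim_stolz[of \<zeta> 2] assms in auto)
qed

text \<open>
  A uniform limit on the Stolz region of functions that are continuous at the vertex has a limit at the vertex:
  the values of the approximants at the vertex form a Cauchy sequence, and the two limits may be interchanged.
\<close>

lemma uniform_approx_imp_limit:
  assumes \<zeta>: "cmod \<zeta> = 1" and "\<alpha> > 1"
    and approx: "\<And>\<epsilon>. \<epsilon> > 0 \<Longrightarrow> \<exists>p. isCont p \<zeta> \<and> (\<forall>z\<in>stolz \<alpha> \<zeta>. cmod (f z - p z) \<le> \<epsilon>)"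
  shows "\<exists>l. (f \<longlongrightarrow> l) (at \<zeta> within stolz \<alpha> \<zeta>)"
proof -
  define F where "F = at \<zeta> within stolz \<alpha> \<zeta>"
  have F: "F \<noteq> bot" unfolding F_def by (rule stolz_nontrivial[OF \<zeta> \<open>\<alpha> > 1\<close>])
  have inS: "\<forall>\<^sub>F z in F. z \<in> stolz \<alpha> \<zeta>"
    unfolding F_def by (simp add: eventually_at_filter)
  obtain p where p: "\<And>i. isCont (p i) \<zeta>"
      "\<And>i z. z \<in> stolz \<alpha> \<zeta> \<Longrightarrow> cmod (f z - p i z) \<le> inverse (real (Suc i))"
    using approx[of "inverse (real (Suc _))"] by (metis of_nat_0_less_iff positive_imp_inverse_positive zero_less_Suc)
  have plim: "(p i \<longlongrightarrow> p i \<zeta>) F" for i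
    using p(1)[of i] unfolding F_def isCont_def by (rule tendsto_within_subset) auto
  have diff: "cmod (p i \<zeta> - p j \<zeta>) \<le> inverse (real (Suc i)) + inverse (real (Suc j))" for i j
  proof (rule tendsto_upperbound)
    show "((\<lambda>z. cmod (p i z - p j z)) \<longlongrightarrow> cmod (p i \<zeta> - p j \<zeta>)) F"
      by (intro tendsto_intros plim)
    show "\<forall>\<^sub>F z in F. cmod (p i z - p j z) \<le> inverse (real (Suc i)) + inverse (real (Suc j))"
      using inS
    proof eventually_elim
      case (elim z)
      have "cmod (p i z - p j z) = cmod ((f z - p j z) - (f z - p i z))" by simp
      also have "\<dots> \<le> cmod (f z - p j z) + cmod (f z - p i z)" by (rule norm_triangle_ineq4)
      finally show ?case using p(2)[OF elim, of i] p(2)[OF elim, of j] by linarith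
    qed
  qed (rule F)
  have "Cauchy (\<lambda>i. p i \<zeta>)"
  proof (rule metric_CauchyI)
    fix e :: real assume "e > 0"
    then obtain N where N: "inverse (real (Suc N)) < e / 2"
      using reals_Archimedean[of "e / 2"] by auto
    show "\<exists>M. \<forall>m\<ge>M. \<forall>n\<ge>M. dist (p m \<zeta>) (p n \<zeta>) < e"
    proof (intro exI allI impI)
      fix m n assume "N \<le> m" "N \<le> n"
      then have "inverse (real (Suc m)) \<le> inverse (real (Suc N))" "inverse (real (Suc n)) \<le> inverse (real (Suc N))"
        by (auto simp: le_imp_inverse_le)
      then show "dist (p m \<zeta>) (p n \<zeta>) < e"
        using diff[of m n] N unfolding dist_norm by linarith
    qed
  qed
  then obtain l where l: "(\<lambda>i. p i \<zeta>) \<longlonglongrightarrow> l"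
    using Cauchy_convergent convergent_def by blast
  have unif: "uniform_limit (stolz \<alpha> \<zeta>) p f sequentially"
  proof (rule uniform_limitI)
    fix e :: real assume "e > 0"
    then have "\<forall>\<^sub>F i in sequentially. inverse (real (Suc i)) < e"
      using LIMSEQ_inverse_real_of_nat by (rule order_tendstoD(2)[rotated])
    then show "\<forall>\<^sub>F i in sequentially. \<forall>z\<in>stolz \<alpha> \<zeta>. dist (p i z) (f z) < e"
    proof eventually_elim
      case (elim i)
      show ?case
      proof
        fix z assume "z \<in> stolz \<alpha> \<zeta>"
        from p(2)[OF this, of i] elim show "dist (p i z) (f z) < e"
          by (metis dist_norm dist_commute le_less_trans)
      qed
    qed
  qed
  have "(f \<longlongrightarrow> l) F"
    unfolding F_def
    by (rule swap_uniform_limit[OF _ l unif]) (use plim in \<open>auto simp: F_def\<close>)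
  then show ?thesis unfolding F_def by blast
qed

text \<open>
  For fixed \<open>n\<close>, a point where the remainder \<open>f - \<Sum>\<^sub>k\<^sub><\<^sub>n a\<^sub>k z\<^sup>k\<close> exceeds \<open>\<epsilon>\<close> in the Stolz region is one where almost all of the
  blocks from \<open>n\<close> to \<open>m\<close> exceed \<open>\<epsilon>\<close>. The weak type estimate covers the exceptional set of each block by a set \<open>T n m\<close> of
  measure at most a constant times the tail of \<open>\<Sum>\<^sub>k \<bar>a\<^sub>k\<bar>\<^sup>2\<close>, uniformly in \<open>m\<close>. The limes inferior of these sets obeys the same bound,
  which tends to \<open>0\<close> with \<open>n\<close>.
\<close>

lemma approximation_bad_set_negligible:
  assumes f: "h2_series a f" and "\<alpha> > 1" "\<epsilon> > 0"
  shows "negligible {\<theta> \<in> {0..2*pi}. \<forall>n. \<exists>z\<in>stolz \<alpha> (cis \<theta>). cmod (f z - (\<Sum>k<n. a k * z ^ k)) > \<epsilon>}"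
    (is "negligible ?Bad")
proof -
  have summ: "summable (\<lambda>k. (cmod (a k))\<^sup>2)" using f by (simp add: h2_series_def)
  define q where "q n m z = (\<Sum>k\<in>{n..<m}. a k * z ^ k)" for n m z
  define C where "C = 640 * (1 + \<alpha>) / \<epsilon>\<^sup>2"
  have "C \<ge> 0" using assms by (simp add: C_def)
  define Q where "Q n m T \<longleftrightarrow> T \<in> lmeasurable
      \<and> {\<theta> \<in> {0..2*pi}. \<exists>z\<in>stolz \<alpha> (cis \<theta>). cmod (q n m z) > \<epsilon>} \<subseteq> T
      \<and> measure lebesgue T \<le> C * tail_normsq a n" for n m T
  have exQ: "\<exists>T. Q n m T" for n m
  proof -
    obtain T where T: "T \<in> lmeasurable" "{\<theta> \<in> {0..2*pi}. \<exists>z\<in>stolz \<alpha> (cis \<theta>). cmod (q n m z) > \<epsilon>} \<subseteq> T"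
        "measure lebesgue T \<le> C * L2_normsq (q n m)"
    proof (rule nontangential_weak_type[OF _ _ \<open>\<alpha> > 1\<close> \<open>\<epsilon> > 0\<close>])
      show "continuous_on (cball 0 1) (q n m)" "q n m holomorphic_on ball 0 1"
        unfolding q_def by (intro continuous_intros holomorphic_intros)+
    qed (auto simp: C_def)
    have "L2_normsq (q n m) \<le> tail_normsq a n"
      unfolding q_def using segment_le_tail_normsq[OF summ] by (subst L2_normsq_polynomial) auto
    with T(3) \<open>C \<ge> 0\<close> have "measure lebesgue T \<le> C * tail_normsq a n"
      by (meson mult_left_mono order_trans)
    with T(1,2) show ?thesis unfolding Q_def by blast
  qed
  define T where "T n m = (SOME T. Q n m T)" for n m
  have "Q n m (T n m)" for n m
    unfolding T_def by (rule someI_ex[OF exQ])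
  then have T: "\<And>n m. T n m \<in> lmeasurable"
      "\<And>n m. {\<theta> \<in> {0..2*pi}. \<exists>z\<in>stolz \<alpha> (cis \<theta>). cmod (q n m z) > \<epsilon>} \<subseteq> T n m"
      "\<And>n m. measure lebesgue (T n m) \<le> C * tail_normsq a n"
    unfolding Q_def by blast+
  \<comment> \<open>the limes inferior of \<open>T n m\<close> as \<open>m\<close> grows\<close>
  define V where "V n = (\<Union>i. \<Inter>m\<in>{i..}. T n m)" for n
  have bad_V: "?Bad \<subseteq> V n" for n
  proof
    fix \<theta> assume \<theta>: "\<theta> \<in> ?Bad"
    then obtain z where z: "z \<in> stolz \<alpha> (cis \<theta>)" "cmod (f z - (\<Sum>k<n. a k * z ^ k)) > \<epsilon>" by blast
    then have "(\<lambda>k. a k * z ^ k) sums f z" using f by (simp add: h2_series_def stolz_def)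
    then have "(\<lambda>m. (\<Sum>k<m. a k * z ^ k) - (\<Sum>k<n. a k * z ^ k)) \<longlonglongrightarrow> f z - (\<Sum>k<n. a k * z ^ k)"
      unfolding sums_def by (intro tendsto_intros)
    then have "\<forall>\<^sub>F m in sequentially. cmod ((\<Sum>k<m. a k * z ^ k) - (\<Sum>k<n. a k * z ^ k)) > \<epsilon>"
      using z(2) by (intro order_tendstoD(1)[OF tendsto_norm])
    moreover have "\<forall>\<^sub>F m in sequentially. m \<ge> n" by (rule eventually_ge_at_top)
    ultimately have "\<forall>\<^sub>F m in sequentially. \<theta> \<in> T n m"
    proof eventually_elim
      case (elim m)
      have "(\<Sum>k<m. a k * z ^ k) - (\<Sum>k<n. a k * z ^ k) = q n m z"
        using sum_diff_nat_ivl[of 0 n m "\<lambda>k. a k * z ^ k"] elim(2) by (simp add: q_def lessThan_atLeast0)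
      then show ?case using elim z(1) \<theta> T(2)[of n m] by auto
    qed
    then show "\<theta> \<in> V n" by (auto simp: V_def eventually_sequentially)
  qed
  have V: "V n \<in> lmeasurable" "measure lebesgue (V n) \<le> C * tail_normsq a n" for n
  proof -
    have S: "(\<Inter>m\<in>{i..}. T n m) \<in> lmeasurable" for i
      by (rule fmeasurable_INT[of _ i]) (use T(1) in \<open>auto simp: fmeasurableD\<close>)
    have B: "measure lebesgue (\<Union>i\<le>j. \<Inter>m\<in>{i..}. T n m) \<le> C * tail_normsq a n" for j
    proof -
      have "measure lebesgue (\<Union>i\<le>j. \<Inter>m\<in>{i..}. T n m) \<le> measure lebesgue (T n j)"
        using S T(1) by (intro measure_mono_fmeasurable) (auto intro!: fmeasurableD)
      with T(3) show ?thesis by (rule order_trans[rotated])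
    qed
    show "V n \<in> lmeasurable" unfolding V_def by (rule fmeasurable_countable_Union[OF S B])
    show "measure lebesgue (V n) \<le> C * tail_normsq a n"
      unfolding V_def by (rule measure_countable_Union_le[OF S B])
  qed
  show ?thesis
    unfolding negligible_outer_le
  proof (intro allI impI)
    fix e :: real assume "e > 0"
    have "(\<lambda>n. C * tail_normsq a n) \<longlonglongrightarrow> C * 0"
      by (intro tendsto_intros tail_normsq_tendsto_0 summ)
    then have "\<forall>\<^sub>F n in sequentially. C * tail_normsq a n < e"
      using \<open>e > 0\<close> by (intro order_tendstoD(2)) auto
    then obtain n where "C * tail_normsq a n < e" by (auto simp: eventually_sequentially)
    with V[of n] bad_V[of n] show "\<exists>T. ?Bad \<subseteq> T \<and> T \<in> lmeasurable \<and> measure lebesgue T \<le> e"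
      by (meson less_imp_le order_trans)
  qed
qed

text \<open>
  Countably many Stolz apertures \<open>j + 2\<close> and tolerances \<open>1 / (i + 1)\<close> suffice, so the exceptional sets together are null.
  The limits for different apertures agree because all regions contain the one of aperture \<open>2\<close>.
\<close>

lemma Fatou_nontangential:
  assumes f: "h2_series a f"
  shows "AE \<theta> in circ. has_nt_limit f (cis \<theta>) (bdry f (cis \<theta>))"
proof -
  define N where "N j i = {\<theta> \<in> {0..2*pi}. \<forall>n. \<exists>z\<in>stolz (real j + 2) (cis \<theta>).
      cmod (f z - (\<Sum>k<n. a k * z ^ k)) > inverse (real (Suc i))}" for j i
  have "negligible (N j i)" for j i
    unfolding N_def by (intro approximation_bad_set_negligible f) auto
  then have null: "negligible (\<Union>j. \<Union>i. N j i)"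
    by (intro negligible_countable_Union) auto
  have good: "has_nt_limit f (cis \<theta>) (bdry f (cis \<theta>))" if \<theta>: "\<theta> \<in> {0..2*pi}" "\<theta> \<notin> (\<Union>j. \<Union>i. N j i)" for \<theta>
  proof -
    have "\<exists>l. (f \<longlongrightarrow> l) (at (cis \<theta>) within stolz (real j + 2) (cis \<theta>))" for j
    proof (rule uniform_approx_imp_limit)
      fix \<epsilon> :: real assume "\<epsilon> > 0"
      then obtain i where i: "inverse (real (Suc i)) < \<epsilon>" using reals_Archimedean by blast
      have "\<theta> \<notin> N j i" using \<theta> by blast
      then obtain n where n: "\<And>z. z \<in> stolz (real j + 2) (cis \<theta>) \<Longrightarrow> cmod (f z - (\<Sum>k<n. a k * z ^ k)) \<le> inverse (real (Suc i))"
        using \<theta>(1) unfolding N_def by (force simp: not_less)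
      show "\<exists>p. isCont p (cis \<theta>) \<and> (\<forall>z\<in>stolz (real j + 2) (cis \<theta>). cmod (f z - p z) \<le> \<epsilon>)"
        using n i by (intro exI[of _ "\<lambda>z. \<Sum>k<n. a k * z ^ k"]) (force intro!: continuous_intros order_trans[OF n])
    qed auto
    then obtain l where l: "\<And>j. (f \<longlongrightarrow> l j) (at (cis \<theta>) within stolz (real j + 2) (cis \<theta>))"
      by metis
    have l0: "l j = l 0" for j
    proof (rule tendsto_unique[OF stolz_nontrivial[of "cis \<theta>" 2]])
      show "(f \<longlongrightarrow> l j) (at (cis \<theta>) within stolz 2 (cis \<theta>))"
        by (rule tendsto_within_subset[OF l stolz_mono]) simp
      show "(f \<longlongrightarrow> l 0) (at (cis \<theta>) within stolz 2 (cis \<theta>))"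
        using l[of 0] by simp
    qed auto
    have "has_nt_limit f (cis \<theta>) (l 0)"
      unfolding has_nt_limit_def
    proof (intro allI impI)
      fix \<alpha> :: real assume "\<alpha> > 1"
      obtain j where "\<alpha> \<le> real j" using real_arch_simple by blast
      then have "stolz \<alpha> (cis \<theta>) \<subseteq> stolz (real j + 2) (cis \<theta>)" by (intro stolz_mono) simp
      with l[of j] show "(f \<longlongrightarrow> l 0) (at (cis \<theta>) within stolz \<alpha> (cis \<theta>))"
        unfolding l0[of j] by (rule tendsto_within_subset)
    qed
    then show ?thesis by (intro has_nt_limit_bdry[of _ _ "l 0"]) auto
  qed
  have "AE \<theta> in lebesgue. \<theta> \<notin> (\<Union>j. \<Union>i. N j i)"
    using null by (intro AE_not_in) (simp add: negligible_iff_null_sets)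
  then show ?thesis
    by (subst AE_restrict_space_iff) (auto elim!: eventually_mono intro: good)
qed

section \<open>Fourier series of boundary functions and the Riesz projection\<close>

text \<open>
  Fatou's lemma for the squared moduli.
\<close>

lemma L2_normsq_AE_limit:
  assumes F: "\<And>m. F m \<in> L2_circle" "\<And>m::nat. L2_normsq (F m) \<le> B"
    and k: "circle_measurable k"
    and lim: "AE \<theta> in circ. (\<lambda>m. F m (cis \<theta>)) \<longlonglongrightarrow> k (cis \<theta>)"
  shows "k \<in> L2_circle" "L2_normsq k \<le> B"
proof -
  have B: "0 \<le> B" using F(2)[of 0] L2_normsq_nonneg[of "F 0"] by linarith
  have Fint: "(\<integral>\<^sup>+\<theta>. ennreal ((cmod (F m (cis \<theta>)))\<^sup>2) \<partial>circ) \<le> ennreal (2 * pi * B)" for m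
  proof -
    have "(\<integral>\<^sup>+\<theta>. ennreal ((cmod (F m (cis \<theta>)))\<^sup>2) \<partial>circ) = ennreal (2 * pi * L2_normsq (F m))"
      using L2_circle_integrable[OF F(1)[of m]] by (subst nn_integral_eq_integral) (auto simp: L2_normsq_def)
    also have "\<dots> \<le> ennreal (2 * pi * B)" using F(2)[of m] by (intro ennreal_leI) simp
    finally show ?thesis .
  qed
  have meas: "(\<lambda>\<theta>. ennreal ((cmod (F m (cis \<theta>)))\<^sup>2)) \<in> borel_measurable circ" for m
    using L2_circle_measurable[OF F(1)[of m]] unfolding circle_measurable_def by measurable
  have "(\<integral>\<^sup>+\<theta>. ennreal ((cmod (k (cis \<theta>)))\<^sup>2) \<partial>circ)
      = (\<integral>\<^sup>+\<theta>. liminf (\<lambda>m. ennreal ((cmod (F m (cis \<theta>)))\<^sup>2)) \<partial>circ)"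
  proof (rule nn_integral_cong_AE)
    show "AE \<theta> in circ. ennreal ((cmod (k (cis \<theta>)))\<^sup>2) = liminf (\<lambda>m. ennreal ((cmod (F m (cis \<theta>)))\<^sup>2))"
      using lim
    proof eventually_elim
      case (elim \<theta>)
      then have "(\<lambda>m. ennreal ((cmod (F m (cis \<theta>)))\<^sup>2)) \<longlonglongrightarrow> ennreal ((cmod (k (cis \<theta>)))\<^sup>2)"
        by (intro tendsto_intros)
      from lim_imp_Liminf[OF _ this] show ?case by simp
    qed
  qed
  also have "\<dots> \<le> liminf (\<lambda>m. \<integral>\<^sup>+\<theta>. ennreal ((cmod (F m (cis \<theta>)))\<^sup>2) \<partial>circ)"
    by (rule nn_integral_liminf[OF meas])
  also have "\<dots> \<le> ennreal (2 * pi * B)"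
    by (rule Liminf_le) (use Fint in auto)
  finally have le: "(\<integral>\<^sup>+\<theta>. ennreal ((cmod (k (cis \<theta>)))\<^sup>2) \<partial>circ) \<le> ennreal (2 * pi * B)" .
  have int: "integrable circ (\<lambda>\<theta>. (cmod (k (cis \<theta>)))\<^sup>2)"
  proof (rule integrableI_bounded)
    show "(\<lambda>\<theta>. (cmod (k (cis \<theta>)))\<^sup>2) \<in> borel_measurable circ"
      using k unfolding circle_measurable_def by measurable
    show "(\<integral>\<^sup>+\<theta>. ennreal (norm ((cmod (k (cis \<theta>)))\<^sup>2)) \<partial>circ) < \<infinity>"
      using le_less_trans[OF le ennreal_less_top] by simp
  qed
  then show "k \<in> L2_circle" using k by (simp add: L2_circle_def)
  have "ennreal (LINT \<theta>|circ. (cmod (k (cis \<theta>)))\<^sup>2) \<le> ennreal (2 * pi * B)"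
    using le int by (subst (asm) nn_integral_eq_integral) auto
  then have "(LINT \<theta>|circ. (cmod (k (cis \<theta>)))\<^sup>2) \<le> 2 * pi * B"
    using B by (subst (asm) ennreal_le_iff) auto
  then show "L2_normsq k \<le> B" by (simp add: L2_normsq_def field_simps)
qed

lemma h2_series_continuous_circle:
  assumes f: "h2_series a f" and r: "0 \<le> r" "r < 1"
  shows "continuous_on (sphere 0 1) (\<lambda>\<zeta>. f (of_real r * \<zeta>))"
proof (rule continuous_on_compose2[where g = f and t = disk])
  show "continuous_on disk f"
    using f by (intro holomorphic_on_imp_continuous_on power_series_holomorphic[of 0 1 a])
      (auto simp: h2_series_def)
qed (use r in \<open>auto intro!: continuous_intros simp: norm_mult\<close>)

lemma AE_radial_limit:
  assumes f: "h2_series a f"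
  shows "AE \<theta> in circ. (\<lambda>m. f (of_real (radius_seq m) * cis \<theta>)) \<longlonglongrightarrow> bdry f (cis \<theta>)"
  using Fatou_nontangential[OF f] by eventually_elim (rule nt_limit_radial, auto)

text \<open>
  Almost everywhere the boundary function is the pointwise limit of the continuous functions
  \<open>\<zeta> \<mapsto> f (r\<^sub>m \<zeta>)\<close>.
\<close>

lemma bdry_circle_measurable:
  assumes f: "h2_series a f"
  shows "circle_measurable (bdry f)"
proof (rule circle_measurable_AE_cong)
  have "(\<lambda>\<theta>. f (of_real (radius_seq m) * cis \<theta>)) \<in> borel_measurable circ" for m
    using circle_measurable_continuous[OF h2_series_continuous_circle[OF f radius_seq]]
    by (simp add: circle_measurable_def)
  then show "circle_measurable (\<lambda>\<zeta>. lim (\<lambda>m. f (of_real (radius_seq m) * \<zeta>)))"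
    unfolding circle_measurable_def by (rule borel_measurable_lim_metric)
  show "AE \<theta> in circ. lim (\<lambda>m. f (of_real (radius_seq m) * cis \<theta>)) = bdry f (cis \<theta>)"
    using AE_radial_limit[OF f] by eventually_elim (rule limI)
qed

text \<open>
  On every smaller circle the remainder has mean at most the tail of the coefficient series, and its radial
  limit is \<open>bdry f\<close> minus the polynomial; Fatou's lemma carries the bound to the unit circle. This identifies the
  nontangential boundary function with the \<open>L\<^sup>2\<close> sum of the Taylor series.
\<close>

lemma bdry_tail:
  assumes f: "h2_series a f"
  shows "(\<lambda>\<zeta>. bdry f \<zeta> - (\<Sum>k<n. a k * \<zeta> ^ k)) \<in> L2_circle" (is "?d \<in> _")
    and "L2_normsq (\<lambda>\<zeta>. bdry f \<zeta> - (\<Sum>k<n. a k * \<zeta> ^ k)) \<le> tail_normsq a n"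
proof -
  define F where "F m \<zeta> = f (of_real (radius_seq m) * \<zeta>) - (\<Sum>k<n. a k * (of_real (radius_seq m) * \<zeta>) ^ k)" for m \<zeta>
  have summ: "summable (\<lambda>k. (cmod (a k))\<^sup>2)" using f by (simp add: h2_series_def)
  have F: "F m \<in> L2_circle" for m
    unfolding F_def
    by (intro L2_circle_continuous continuous_on_diff h2_series_continuous_circle[OF f] radius_seq continuous_intros)
  have bound: "L2_normsq (F m) \<le> tail_normsq a n" for m
    using circle_mean_le_suminf[OF h2_series_tail[OF f, of n] radius_seq, of m]
    unfolding suminf_truncated[OF summ] by (simp add: circle_mean_eq F_def[abs_def])
  have meas: "circle_measurable ?d"
    by (intro circle_measurable_diff bdry_circle_measurable[OF f] circle_measurable_continuous continuous_intros)
  have lim: "AE \<theta> in circ. (\<lambda>m. F m (cis \<theta>)) \<longlonglongrightarrow> ?d (cis \<theta>)"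
    using AE_radial_limit[OF f]
  proof eventually_elim
    case (elim \<theta>)
    have "(\<lambda>m. \<Sum>k<n. a k * (of_real (radius_seq m) * cis \<theta>) ^ k) \<longlonglongrightarrow> (\<Sum>k<n. a k * (of_real 1 * cis \<theta>) ^ k)"
      by (intro tendsto_intros radius_seq_tendsto)
    with elim show ?case unfolding F_def by (intro tendsto_diff) auto
  qed
  show "?d \<in> L2_circle" "L2_normsq ?d \<le> tail_normsq a n"
    by (rule L2_normsq_AE_limit[where k = ?d, OF F bound meas lim])+
qed

lemma bdry_L2:
  assumes "h2_series a f"
  shows "bdry f \<in> L2_circle"
  using bdry_tail(1)[OF assms, of 0] by simp

lemma L2_inner_tendsto:
  assumes "u \<in> L2_circle" "v \<in> L2_circle" "\<And>n::nat. w n \<in> L2_circle"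
    and "(\<lambda>n. L2_normsq (\<lambda>\<zeta>. v \<zeta> - w n \<zeta>)) \<longlonglongrightarrow> 0"
  shows "(\<lambda>n. L2_inner u (w n)) \<longlonglongrightarrow> L2_inner u v"
proof -
  have "(\<lambda>n. L2_inner u v - L2_inner u (w n)) \<longlonglongrightarrow> 0"
  proof (rule Lim_null_comparison)
    show "\<forall>\<^sub>F n in sequentially. norm (L2_inner u v - L2_inner u (w n))
        \<le> sqrt (L2_normsq u * L2_normsq (\<lambda>\<zeta>. v \<zeta> - w n \<zeta>))"
    proof (intro always_eventually allI real_le_rsqrt)
      fix n
      have "L2_inner u v - L2_inner u (w n) = L2_inner u (\<lambda>\<zeta>. v \<zeta> - w n \<zeta>)"
        by (simp add: L2_inner_diff_right assms)
      then show "(norm (L2_inner u v - L2_inner u (w n)))\<^sup>2 \<le> L2_normsq u * L2_normsq (\<lambda>\<zeta>. v \<zeta> - w n \<zeta>)"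
        using L2_Cauchy_Schwarz[OF assms(1) L2_circle_diff[OF assms(2,3)]] by simp
    qed
    have "(\<lambda>n. sqrt (L2_normsq u * L2_normsq (\<lambda>\<zeta>. v \<zeta> - w n \<zeta>))) \<longlonglongrightarrow> sqrt (L2_normsq u * 0)"
      by (intro tendsto_intros assms(4))
    then show "(\<lambda>n. sqrt (L2_normsq u * L2_normsq (\<lambda>\<zeta>. v \<zeta> - w n \<zeta>))) \<longlonglongrightarrow> 0" by simp
  qed
  then have "(\<lambda>n. L2_inner u v - (L2_inner u v - L2_inner u (w n))) \<longlonglongrightarrow> L2_inner u v - 0"
    by (intro tendsto_intros)
  then show ?thesis by simp
qed

lemma bdry_L2_approx:
  assumes f: "h2_series a f"
  shows "(\<lambda>n. L2_normsq (\<lambda>\<zeta>. bdry f \<zeta> - (\<Sum>k<n. a k * \<zeta> ^ k))) \<longlonglongrightarrow> 0"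
proof (rule tendsto_sandwich[where f = "\<lambda>_. 0" and h = "tail_normsq a"])
  show "tail_normsq a \<longlonglongrightarrow> 0" using f by (intro tail_normsq_tendsto_0) (simp add: h2_series_def)
qed (use bdry_tail(2)[OF f] L2_normsq_nonneg in auto)

lemma L2_inner_bdry_tendsto:
  assumes "h2_series a f" "u \<in> L2_circle"
  shows "(\<lambda>n. L2_inner u (\<lambda>\<zeta>. \<Sum>k<n. a k * \<zeta> ^ k)) \<longlonglongrightarrow> L2_inner u (bdry f)"
  by (intro L2_inner_tendsto assms bdry_L2[OF assms(1)] L2_circle_polynomial bdry_L2_approx)

lemma L2_inner_polynomial_right:
  assumes "u \<in> L2_circle"
  shows "L2_inner u (\<lambda>\<zeta>. \<Sum>k<n. a k * \<zeta> ^ k) = (\<Sum>k<n. cnj (a k) * L2_inner u (\<lambda>\<zeta>. \<zeta> ^ k))"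
  using assms by (simp add: L2_inner_sum_right L2_circle_monomial L2_inner_cmult_right)

lemma bdry_Fourier_coeff:
  assumes f: "h2_series a f"
  shows "L2_inner (bdry f) (\<lambda>\<zeta>. \<zeta> ^ j) = a j"
proof -
  have "(\<lambda>n. L2_inner (\<lambda>\<zeta>. \<zeta> ^ j) (\<lambda>\<zeta>. \<Sum>k<n. a k * \<zeta> ^ k)) \<longlonglongrightarrow> L2_inner (\<lambda>\<zeta>. \<zeta> ^ j) (bdry f)"
    by (intro L2_inner_bdry_tendsto f L2_circle_power)
  moreover have "(\<lambda>n. L2_inner (\<lambda>\<zeta>. \<zeta> ^ j) (\<lambda>\<zeta>. \<Sum>k<n. a k * \<zeta> ^ k)) \<longlonglongrightarrow> cnj (a j)"
  proof (rule tendsto_eventually)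
    show "\<forall>\<^sub>F n in sequentially. L2_inner (\<lambda>\<zeta>. \<zeta> ^ j) (\<lambda>\<zeta>. \<Sum>k<n. a k * \<zeta> ^ k) = cnj (a j)"
      using eventually_gt_at_top[of j]
      by eventually_elim (subst L2_inner_commute, simp add: L2_inner_polynomial_monomial)
  qed
  ultimately have "L2_inner (\<lambda>\<zeta>. \<zeta> ^ j) (bdry f) = cnj (a j)" by (rule LIMSEQ_unique)
  then show ?thesis by (subst L2_inner_commute) simp
qed

text \<open>
  The boundary function is an \<open>L\<^sup>2\<close> limit of polynomials, so being orthogonal to all monomials is enough.
\<close>

lemma L2_inner_bdry_eq_0:
  assumes "h2_series a f" "u \<in> L2_circle" "\<And>k. L2_inner u (\<lambda>\<zeta>. \<zeta> ^ k) = 0"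
  shows "L2_inner u (bdry f) = 0"
  using L2_inner_bdry_tendsto[OF assms(1,2)]
  by (simp add: L2_inner_polynomial_right assms LIMSEQ_const_iff)

lemma L2_normsq_bdry:
  assumes f: "h2_series a f"
  shows "L2_normsq (bdry f) = (H2_norm f)\<^sup>2"
proof -
  have "(\<lambda>n. L2_inner (bdry f) (\<lambda>\<zeta>. \<Sum>k<n. a k * \<zeta> ^ k)) \<longlonglongrightarrow> L2_inner (bdry f) (bdry f)"
    by (intro L2_inner_bdry_tendsto f bdry_L2[OF f])
  moreover have "L2_inner (bdry f) (\<lambda>\<zeta>. \<Sum>k<n. a k * \<zeta> ^ k) = of_real (\<Sum>k<n. (cmod (a k))\<^sup>2)" for n
    using complex_norm_square[of "a _"]
    by (simp add: L2_inner_polynomial_right bdry_L2[OF f] bdry_Fourier_coeff[OF f] mult.commute)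
  ultimately have "(\<lambda>n. complex_of_real (\<Sum>k<n. (cmod (a k))\<^sup>2)) \<longlonglongrightarrow> of_real (L2_normsq (bdry f))"
    by (simp only: L2_inner_self)
  then have "(\<lambda>n. \<Sum>k<n. (cmod (a k))\<^sup>2) \<longlonglongrightarrow> L2_normsq (bdry f)"
    by (simp only: tendsto_of_real_iff)
  moreover have "(\<lambda>n. \<Sum>k<n. (cmod (a k))\<^sup>2) \<longlonglongrightarrow> (\<Sum>k. (cmod (a k))\<^sup>2)"
    using f by (intro summable_LIMSEQ) (simp add: h2_series_def)
  ultimately show ?thesis
    unfolding H2_norm_eq_coeff_norm[OF f] by (rule LIMSEQ_unique)
qed

definition riesz_proj :: "(complex \<Rightarrow> complex) \<Rightarrow> complex \<Rightarrow> complex" where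
  "riesz_proj u = (\<lambda>z\<in>disk. \<Sum>k. L2_inner u (\<lambda>\<zeta>. \<zeta> ^ k) * z ^ k)"

text \<open>
  Expand the squared norm of \<open>u\<close> minus its Fourier polynomial, which is nonnegative.
\<close>

lemma Bessel_inequality:
  assumes u: "u \<in> L2_circle"
  shows "(\<Sum>k<n. (cmod (L2_inner u (\<lambda>\<zeta>. \<zeta> ^ k)))\<^sup>2) \<le> L2_normsq u"
proof -
  define c where "c k = L2_inner u (\<lambda>\<zeta>. \<zeta> ^ k)" for k
  define s where "s \<zeta> = (\<Sum>k<n. c k * \<zeta> ^ k)" for \<zeta>
  have s: "s \<in> L2_circle" unfolding s_def by (rule L2_circle_polynomial)
  have ns: "L2_normsq s = (\<Sum>k<n. (cmod (c k))\<^sup>2)"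
    unfolding s_def by (rule L2_normsq_polynomial) simp
  have "L2_inner u s = (\<Sum>k<n. cnj (c k) * c k)"
    unfolding s_def by (simp add: L2_inner_polynomial_right u c_def)
  also have "\<dots> = of_real (L2_normsq s)"
    using complex_norm_square[of "c _"] by (simp add: ns mult.commute)
  finally have "L2_inner u s = of_real (L2_normsq s)" .
  then have "L2_normsq (\<lambda>\<zeta>. u \<zeta> - s \<zeta>) = L2_normsq u - L2_normsq s"
    using L2_normsq_diff[OF u s] by simp
  with L2_normsq_nonneg[of "\<lambda>\<zeta>. u \<zeta> - s \<zeta>"] show ?thesis
    by (simp add: ns c_def)
qed

lemma square_summable_imp_h2_series:
  assumes "summable (\<lambda>k. (cmod (c k))\<^sup>2)"
  shows "h2_series c (\<lambda>z\<in>disk. \<Sum>k. c k * z ^ k)"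
proof -
  have "(\<lambda>k. c k * z ^ k) sums (\<Sum>k. c k * z ^ k)" if z: "z \<in> disk" for z
  proof (rule summable_sums)
    have "summable (\<lambda>k. (cmod z ^ 2) ^ k)"
      using z by (intro summable_geometric) (simp add: power_less_one_iff)
    with assms have s: "summable (\<lambda>k. (cmod (c k))\<^sup>2 + (cmod z ^ 2) ^ k)" by (rule summable_add)
    show "summable (\<lambda>k. c k * z ^ k)"
    proof (rule summable_comparison_test'[where N = 0, OF s])
      fix k
      have "0 \<le> cmod (c k) * cmod z ^ k" by simp
      then have "cmod (c k) * cmod z ^ k \<le> (cmod (c k))\<^sup>2 + (cmod z ^ k)\<^sup>2"
        using sum_squares_bound[of "cmod (c k)" "cmod z ^ k"] by linarith
      then show "norm (c k * z ^ k) \<le> (cmod (c k))\<^sup>2 + (cmod z ^ 2) ^ k"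
        by (simp add: norm_mult norm_power mult.commute flip: power_mult)
    qed
  qed
  with assms show ?thesis by (simp add: h2_series_def)
qed

lemma riesz_proj_series:
  assumes u: "u \<in> L2_circle"
  shows "h2_series (\<lambda>k. L2_inner u (\<lambda>\<zeta>. \<zeta> ^ k)) (riesz_proj u)"
  unfolding riesz_proj_def
  by (intro square_summable_imp_h2_series summableI_nonneg_bounded[OF _ Bessel_inequality[OF u]]) auto

lemma riesz_proj_H2: "u \<in> L2_circle \<Longrightarrow> riesz_proj u \<in> H2"
  by (rule h2_series_imp_H2[OF riesz_proj_series]) (auto simp: riesz_proj_def)

text \<open>
  This says that \<open>u - P\<^sub>+ u\<close> is orthogonal to \<open>H\<^sup>2\<close>; \<open>u\<close> and \<open>P\<^sub>+ u\<close> have the same Fourier coefficients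
  of nonnegative index, and the boundary functions in \<open>H\<^sup>2\<close> are limits of polynomials.
\<close>

lemma riesz_proj_inner:
  assumes u: "u \<in> L2_circle" and h: "h \<in> H2"
  shows "L2_inner (bdry (riesz_proj u)) (bdry h) = L2_inner u (bdry h)"
proof -
  obtain a where a: "h2_series a h" using h by (rule H2_imp_h2_series)
  have b: "bdry (riesz_proj u) \<in> L2_circle" by (rule bdry_L2[OF riesz_proj_series[OF u]])
  have "L2_inner (\<lambda>\<zeta>. u \<zeta> - bdry (riesz_proj u) \<zeta>) (bdry h) = 0"
  proof (rule L2_inner_bdry_eq_0[OF a])
    show "(\<lambda>\<zeta>. u \<zeta> - bdry (riesz_proj u) \<zeta>) \<in> L2_circle"
      by (intro L2_circle_diff u b)
    show "L2_inner (\<lambda>\<zeta>. u \<zeta> - bdry (riesz_proj u) \<zeta>) (\<lambda>\<zeta>. \<zeta> ^ k) = 0" for k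
      by (simp add: L2_inner_diff_left u b L2_circle_power bdry_Fourier_coeff[OF riesz_proj_series[OF u]])
  qed
  then show ?thesis
    by (simp add: L2_inner_diff_left u b bdry_L2[OF a])
qed

section \<open>Algebra of boundary functions\<close>

lemma H2_bdry_L2: "f \<in> H2 \<Longrightarrow> bdry f \<in> L2_circle"
  using H2_imp_h2_series bdry_L2 by metis

lemma H2_bdry_measurable: "f \<in> H2 \<Longrightarrow> circle_measurable (bdry f)"
  by (intro L2_circle_measurable H2_bdry_L2)

lemma H2_norm_sq: "f \<in> H2 \<Longrightarrow> (H2_norm f)\<^sup>2 = L2_normsq (bdry f)"
  using H2_imp_h2_series L2_normsq_bdry by metis

lemma H2_nt_limit: "f \<in> H2 \<Longrightarrow> AE \<theta> in circ. has_nt_limit f (cis \<theta>) (bdry f (cis \<theta>))"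
  using H2_imp_h2_series Fatou_nontangential by metis

lemma H2_fdiff:
  assumes "f \<in> H2" "k \<in> H2" shows "fdiff f k \<in> H2"
proof -
  obtain a b where "h2_series a f" "h2_series b k" using assms H2_imp_h2_series by metis
  from h2_series_add[OF this(1) h2_series_cmult[OF this(2), of "-1"]]
  have "h2_series (\<lambda>n. a n + -1 * b n) (fdiff f k)"
    by (simp add: fdiff_def cong: restrict_cong)
  then show ?thesis by (rule h2_series_imp_H2) (simp add: fdiff_def)
qed

lemma H2_cmult:
  assumes "f \<in> H2" shows "(\<lambda>z\<in>disk. c * f z) \<in> H2"
proof -
  obtain a where "h2_series a f" using assms H2_imp_h2_series by metis
  from h2_series_cmult[OF this, of c] show ?thesis by (rule h2_series_imp_H2) simp
qed

text \<open>
  Nontangential limits only see values inside the disk. This transfers limit laws to products and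
  differences that are set to the default value outside the disk.
\<close>

lemma has_nt_limit_cong:
  assumes "\<And>z. z \<in> disk \<Longrightarrow> f z = k z"
  shows "has_nt_limit f \<zeta> l \<longleftrightarrow> has_nt_limit k \<zeta> l"
  unfolding has_nt_limit_def
  by (intro all_cong1 imp_cong refl filterlim_cong) (auto simp: eventually_at_filter stolz_def assms)

text \<open>
  Where both factors have nontangential limits, so does the product. This pointwise argument covers
  \<open>g h\<close> with unbounded \<open>g\<close>.
\<close>

lemma bdry_fmult:
  assumes "f \<in> H2" "k \<in> H2"
  shows "AE \<theta> in circ. bdry (fmult f k) (cis \<theta>) = bdry f (cis \<theta>) * bdry k (cis \<theta>)"
  using H2_nt_limit[OF assms(1)] H2_nt_limit[OF assms(2)]
proof eventually_elim
  case (elim \<theta>)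
  then have "has_nt_limit (\<lambda>z. f z * k z) (cis \<theta>) (bdry f (cis \<theta>) * bdry k (cis \<theta>))"
    by (auto simp: has_nt_limit_def intro: tendsto_mult)
  then have "has_nt_limit (fmult f k) (cis \<theta>) (bdry f (cis \<theta>) * bdry k (cis \<theta>))"
    by (subst has_nt_limit_cong[of _ "\<lambda>z. f z * k z"]) (auto simp: fmult_def)
  then show ?case by (intro bdry_eqI) auto
qed

lemma bdry_fdiff:
  assumes "f \<in> H2" "k \<in> H2"
  shows "AE \<theta> in circ. bdry (fdiff f k) (cis \<theta>) = bdry f (cis \<theta>) - bdry k (cis \<theta>)"
  using H2_nt_limit[OF assms(1)] H2_nt_limit[OF assms(2)]
proof eventually_elim
  case (elim \<theta>)
  then have "has_nt_limit (\<lambda>z. f z - k z) (cis \<theta>) (bdry f (cis \<theta>) - bdry k (cis \<theta>))"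
    by (auto simp: has_nt_limit_def intro: tendsto_diff)
  then have "has_nt_limit (fdiff f k) (cis \<theta>) (bdry f (cis \<theta>) - bdry k (cis \<theta>))"
    by (subst has_nt_limit_cong[of _ "\<lambda>z. f z - k z"]) (auto simp: fdiff_def)
  then show ?case by (intro bdry_eqI) auto
qed

lemma bdry_cmult:
  assumes "f \<in> H2"
  shows "AE \<theta> in circ. bdry (\<lambda>z\<in>disk. c * f z) (cis \<theta>) = c * bdry f (cis \<theta>)"
  using H2_nt_limit[OF assms]
proof eventually_elim
  case (elim \<theta>)
  then have "has_nt_limit (\<lambda>z. c * f z) (cis \<theta>) (c * bdry f (cis \<theta>))"
    by (auto simp: has_nt_limit_def intro: tendsto_mult_left)
  then have "has_nt_limit (\<lambda>z\<in>disk. c * f z) (cis \<theta>) (c * bdry f (cis \<theta>))"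
    by (subst has_nt_limit_cong[of _ "\<lambda>z. c * f z"]) auto
  then show ?case by (intro bdry_eqI) auto
qed

lemma L2_normsq_AE_cong:
  assumes "circle_measurable f" "circle_measurable f'" "AE \<theta> in circ. f (cis \<theta>) = f' (cis \<theta>)"
  shows "L2_normsq f = L2_normsq f'"
  using L2_inner_AE_cong[OF assms(1,2,1,2,3,3)] by (simp add: L2_inner_self)

lemma L2_normsq_bdry_fdiff:
  assumes "f \<in> H2" "k \<in> H2"
  shows "L2_normsq (bdry (fdiff f k)) = L2_normsq (\<lambda>\<zeta>. bdry f \<zeta> - bdry k \<zeta>)"
  using assms by (intro L2_normsq_AE_cong bdry_fdiff H2_bdry_measurable H2_fdiff circle_measurable_diff)

lemma L2_inner_bdry_fdiff_left:
  assumes "f \<in> H2" "k \<in> H2" "u \<in> L2_circle"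
  shows "L2_inner (bdry (fdiff f k)) u = L2_inner (bdry f) u - L2_inner (bdry k) u"
proof -
  have "L2_inner (bdry (fdiff f k)) u = L2_inner (\<lambda>\<zeta>. bdry f \<zeta> - bdry k \<zeta>) u"
    using assms by (intro L2_inner_AE_cong bdry_fdiff H2_bdry_measurable H2_fdiff circle_measurable_diff
      L2_circle_measurable) auto
  then show ?thesis using assms by (simp add: L2_inner_diff_left H2_bdry_L2)
qed

lemma L2_inner_bdry_fdiff_right:
  assumes "f \<in> H2" "k \<in> H2" "u \<in> L2_circle"
  shows "L2_inner u (bdry (fdiff f k)) = L2_inner u (bdry f) - L2_inner u (bdry k)"
  by (simp add: L2_inner_commute[of u] L2_inner_bdry_fdiff_left assms)

lemma H2_inner_fdiff_right:
  assumes "f \<in> H2" "k \<in> H2" "h \<in> H2"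
  shows "H2_inner h (fdiff f k) = H2_inner h f - H2_inner h k"
  using assms by (simp add: H2_inner_def L2_inner_bdry_fdiff_right H2_bdry_L2)

lemma H2_inner_cmult_left:
  assumes "f \<in> H2" "h \<in> H2"
  shows "H2_inner (\<lambda>z\<in>disk. c * f z) h = c * H2_inner f h"
proof -
  have "H2_inner (\<lambda>z\<in>disk. c * f z) h = L2_inner (\<lambda>\<zeta>. c * bdry f \<zeta>) (bdry h)"
    unfolding H2_inner_def using assms
    by (intro L2_inner_AE_cong bdry_cmult H2_bdry_measurable H2_cmult L2_circle_measurable[OF L2_circle_cmult]
        H2_bdry_L2) auto
  then show ?thesis by (simp add: L2_inner_cmult_left H2_inner_def)
qed

lemma H2_inner_self: "f \<in> H2 \<Longrightarrow> H2_inner f f = of_real ((H2_norm f)\<^sup>2)"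
  by (simp add: H2_inner_def L2_inner_self H2_norm_sq del: of_real_power)

lemma H2_norm_fdiff_sq:
  assumes "f \<in> H2" "k \<in> H2"
  shows "(H2_norm (fdiff f k))\<^sup>2 = (H2_norm f)\<^sup>2 + (H2_norm k)\<^sup>2 - 2 * Re (H2_inner f k)"
  using assms by (simp add: H2_norm_sq H2_fdiff L2_normsq_bdry_fdiff L2_normsq_diff H2_bdry_L2 H2_inner_def)

lemma H2_fdiff_eq_0_imp_eq:
  assumes f: "f \<in> H2" and k: "k \<in> H2" and "H2_norm (fdiff f k) = 0"
  shows "f = k"
proof -
  obtain a where a: "h2_series a (fdiff f k)" using H2_fdiff[OF f k] by (rule H2_imp_h2_series)
  have "(\<Sum>j. (cmod (a j))\<^sup>2) = 0"
    using H2_norm_eq_coeff_norm[OF a] assms(3) by simp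
  then have "\<forall>j. (cmod (a j))\<^sup>2 = 0"
    using a by (subst (asm) suminf_eq_zero_iff) (auto simp: h2_series_def)
  then have a0: "a = (\<lambda>_. 0)" by auto
  have "f z = k z" if "z \<in> disk" for z
  proof -
    have "(\<lambda>j. a j * z ^ j) sums fdiff f k z" using a that by (simp add: h2_series_def)
    then have "fdiff f k z = 0" by (simp add: a0 sums_iff)
    then show ?thesis using that by (simp add: fdiff_def)
  qed
  then show ?thesis using f k by (intro extensionalityI[of f disk]) (auto simp: H2_def)
qed

text \<open>
  The value at \<open>0\<close> is the Taylor coefficient of index \<open>0\<close>, hence a Fourier coefficient of the boundary function.
\<close>

lemma H2_value_at_0:
  assumes "f \<in> H2"
  shows "L2_inner (bdry f) (\<lambda>\<zeta>. 1) = f 0"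
proof -
  obtain a where a: "h2_series a f" using assms by (rule H2_imp_h2_series)
  then have "\<forall>z\<in>disk. (\<lambda>j. a j * z ^ j) sums f z" by (simp add: h2_series_def)
  from bspec[OF this, of 0] have "f 0 = a 0" by simp
  then show ?thesis using bdry_Fourier_coeff[OF a, of 0] by simp
qed

lemma L2_normsq_mono:
  assumes "k \<in> L2_circle" "AE \<theta> in circ. cmod (f (cis \<theta>)) \<le> B * cmod (k (cis \<theta>))"
  shows "L2_normsq f \<le> B\<^sup>2 * L2_normsq k"
proof -
  have "(LINT \<theta>|circ. (cmod (f (cis \<theta>)))\<^sup>2) \<le> (LINT \<theta>|circ. B\<^sup>2 * (cmod (k (cis \<theta>)))\<^sup>2)"
  proof (rule integral_mono_AE')
    show "AE \<theta> in circ. (cmod (f (cis \<theta>)))\<^sup>2 \<le> B\<^sup>2 * (cmod (k (cis \<theta>)))\<^sup>2"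
      using assms(2)
    proof eventually_elim
      case (elim \<theta>)
      then have "(cmod (f (cis \<theta>)))\<^sup>2 \<le> (B * cmod (k (cis \<theta>)))\<^sup>2" by (intro power_mono) auto
      then show ?case by (simp add: power_mult_distrib)
    qed
  qed (use L2_circle_integrable[OF assms(1)] in auto)
  then show ?thesis by (simp add: L2_normsq_def divide_right_mono)
qed

text \<open>
  The circle means of the product are at most \<open>B\<^sup>2\<close> times those of \<open>f\<close>.
\<close>

lemma fmult_bounded_H2:
  assumes hol: "b holomorphic_on disk" and B: "\<And>z. z \<in> disk \<Longrightarrow> cmod (b z) \<le> B" and f: "f \<in> H2"
  shows "fmult b f \<in> H2"
proof -
  obtain a where a: "h2_series a f" using f by (rule H2_imp_h2_series)
  have "(\<lambda>z. b z * f z) holomorphic_on disk"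
    using f by (intro holomorphic_intros hol) (simp add: H2_def)
  then have "fmult b f holomorphic_on disk"
    by (rule holomorphic_transform) (simp add: fmult_def)
  moreover have "circle_mean (fmult b f) r \<le> B\<^sup>2 * (\<Sum>k. (cmod (a k))\<^sup>2)" if r: "0 \<le> r" "r < 1" for r
  proof -
    have "circle_mean (fmult b f) r \<le> B\<^sup>2 * circle_mean f r"
      unfolding circle_mean_eq
    proof (intro L2_normsq_mono L2_circle_continuous h2_series_continuous_circle[OF a r] AE_I2)
      fix \<theta>
      have "of_real r * cis \<theta> \<in> disk" using r by (simp add: norm_mult)
      then show "cmod (fmult b f (of_real r * cis \<theta>)) \<le> B * cmod (f (of_real r * cis \<theta>))"
        using B by (simp add: fmult_def norm_mult mult_right_mono)
    qed
    also have "\<dots> \<le> B\<^sup>2 * (\<Sum>k. (cmod (a k))\<^sup>2)"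
      by (intro mult_left_mono circle_mean_le_suminf[OF a r]) auto
    finally show ?thesis .
  qed
  then have "bdd_above (circle_mean (fmult b f) ` {0..<1})"
    by (intro bdd_aboveI2) auto
  ultimately show ?thesis by (simp add: H2_def fmult_def)
qed

lemma const_H2: "(\<lambda>z\<in>disk. c) \<in> H2"
proof (rule h2_series_imp_H2)
  show "h2_series (\<lambda>k. if k \<in> {0} then c else 0) (\<lambda>z\<in>disk. c)"
    unfolding h2_series_def
  proof (intro conjI ballI)
    show "summable (\<lambda>k. (cmod (if k \<in> {0::nat} then c else 0))\<^sup>2)"
      by (rule summable_finite[of "{0}"]) auto
    fix z :: complex assume "z \<in> disk"
    then show "(\<lambda>k. (if k \<in> {0} then c else 0) * z ^ k) sums (\<lambda>z\<in>disk. c) z"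
      using sums_finite[of "{0}" "\<lambda>k. (if k \<in> {0} then c else 0) * z ^ k"] by simp
  qed
qed simp

lemma bounded_holomorphic_H2:
  assumes "b \<in> extensional disk" "b holomorphic_on disk" "bounded (b ` disk)"
  shows "b \<in> H2"
proof -
  obtain B where B: "\<And>z. z \<in> disk \<Longrightarrow> cmod (b z) \<le> B"
    using assms(3) unfolding bounded_iff by (metis imageI)
  have "fmult b (\<lambda>z\<in>disk. 1) \<in> H2"
    by (rule fmult_bounded_H2[OF assms(2) B const_H2])
  moreover have "fmult b (\<lambda>z\<in>disk. 1) = b"
    using assms(1) by (intro extensionalityI[of _ disk]) (auto simp: fmult_def)
  ultimately show ?thesis by simp
qed

lemma bdry_bounded:
  assumes f: "f \<in> H2" and B: "\<And>z. z \<in> disk \<Longrightarrow> cmod (f z) \<le> B"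
  shows "AE \<theta> in circ. cmod (bdry f (cis \<theta>)) \<le> B"
  using H2_nt_limit[OF f]
proof eventually_elim
  case (elim \<theta>)
  then have "(\<lambda>m. cmod (f (of_real (radius_seq m) * cis \<theta>))) \<longlonglongrightarrow> cmod (bdry f (cis \<theta>))"
    by (intro tendsto_norm nt_limit_radial) auto
  then show ?case
  proof (rule tendsto_upperbound)
    show "\<forall>\<^sub>F m in sequentially. cmod (f (of_real (radius_seq m) * cis \<theta>)) \<le> B"
      using B radius_seq by (intro always_eventually allI) (simp add: norm_mult)
  qed simp
qed

section \<open>The projection onto a model space\<close>

lemma model_space_H2: "h \<in> model_space I \<Longrightarrow> h \<in> H2"
  by (simp add: model_space_def)

context
  fixes I :: "complex \<Rightarrow> complex"
  assumes I: "inner_function I"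
begin

lemma inner_H2: "I \<in> H2"
  using I by (intro bounded_holomorphic_H2) (auto simp: inner_function_def)

lemma inner_bounded: obtains B where "\<And>z. z \<in> disk \<Longrightarrow> cmod (I z) \<le> B"
  using I unfolding inner_function_def bounded_iff by (metis imageI)

lemma inner_fmult_H2: "k \<in> H2 \<Longrightarrow> fmult I k \<in> H2"
  using I inner_bounded fmult_bounded_H2 unfolding inner_function_def by metis

lemma bdry_inner_AE: "AE \<theta> in circ. cmod (bdry I (cis \<theta>)) = 1"
  using I by (simp add: inner_function_def)

lemma bdry_inner_L2:
  assumes "u \<in> L2_circle"
  shows "(\<lambda>\<zeta>. u \<zeta> * bdry I \<zeta>) \<in> L2_circle" "(\<lambda>\<zeta>. u \<zeta> * cnj (bdry I \<zeta>)) \<in> L2_circle"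
  using bdry_inner_AE
  by (auto intro!: L2_circle_mult_bounded[OF assms, where B = 1] H2_bdry_measurable inner_H2 elim: eventually_mono)

text \<open>
  \<open>\<bar>I\<bar> = 1\<close> almost everywhere on the circle.
\<close>

lemma inner_mult_isometry:
  assumes "f \<in> H2" "k \<in> H2"
  shows "L2_inner (bdry (fmult I f)) (bdry (fmult I k)) = L2_inner (bdry f) (bdry k)"
proof -
  have "(LINT \<theta>|circ. bdry (fmult I f) (cis \<theta>) * cnj (bdry (fmult I k) (cis \<theta>)))
      = (LINT \<theta>|circ. bdry f (cis \<theta>) * cnj (bdry k (cis \<theta>)))"
  proof (rule integral_cong_AE)
    show "AE \<theta> in circ. bdry (fmult I f) (cis \<theta>) * cnj (bdry (fmult I k) (cis \<theta>))
        = bdry f (cis \<theta>) * cnj (bdry k (cis \<theta>))"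
      using bdry_fmult[OF inner_H2 assms(1)] bdry_fmult[OF inner_H2 assms(2)] bdry_inner_AE
    proof eventually_elim
      case (elim \<theta>)
      have "bdry I (cis \<theta>) * cnj (bdry I (cis \<theta>)) = 1"
        using elim(3) complex_norm_square[of "bdry I (cis \<theta>)"] by simp
      moreover have "bdry (fmult I f) (cis \<theta>) * cnj (bdry (fmult I k) (cis \<theta>))
          = (bdry I (cis \<theta>) * cnj (bdry I (cis \<theta>))) * (bdry f (cis \<theta>) * cnj (bdry k (cis \<theta>)))"
        by (simp add: elim mult_ac)
      ultimately show ?case by simp
    qed
    show "(\<lambda>\<theta>. bdry (fmult I f) (cis \<theta>) * cnj (bdry (fmult I k) (cis \<theta>))) \<in> borel_measurable circ"
      by (intro borel_measurable_integrable L2_inner_integrable H2_bdry_L2 inner_fmult_H2 assms)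
    show "(\<lambda>\<theta>. bdry f (cis \<theta>) * cnj (bdry k (cis \<theta>))) \<in> borel_measurable circ"
      by (intro borel_measurable_integrable L2_inner_integrable H2_bdry_L2 assms)
  qed
  then show ?thesis by (simp add: L2_inner_def)
qed

lemma L2_inner_inner_adjoint:
  assumes "u \<in> L2_circle" "k \<in> H2"
  shows "L2_inner u (bdry (fmult I k)) = L2_inner (\<lambda>\<zeta>. u \<zeta> * cnj (bdry I \<zeta>)) (bdry k)"
proof -
  have "L2_inner u (bdry (fmult I k)) = L2_inner u (\<lambda>\<zeta>. bdry I \<zeta> * bdry k \<zeta>)"
    using assms by (intro L2_inner_AE_cong bdry_fmult H2_bdry_measurable inner_fmult_H2 inner_H2
      L2_circle_measurable circle_measurable_mult) auto
  then show ?thesis by (simp add: L2_inner_def mult_ac)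
qed

lemma model_spaceI:
  assumes "f \<in> H2" "\<And>k. k \<in> H2 \<Longrightarrow> L2_inner (bdry f) (bdry (fmult I k)) = 0"
  shows "f \<in> model_space I"
  using assms by (auto simp: model_space_def H2_inner_def)

lemma model_space_orthogonal:
  "f \<in> model_space I \<Longrightarrow> k \<in> H2 \<Longrightarrow> L2_inner (bdry f) (bdry (fmult I k)) = 0"
  by (auto simp: model_space_def H2_inner_def)

lemma model_space_fdiff:
  assumes "f \<in> model_space I" "k \<in> model_space I"
  shows "fdiff f k \<in> model_space I"
  using assms by (intro model_spaceI)
    (auto simp: L2_inner_bdry_fdiff_left model_space_orthogonal model_space_H2 H2_fdiff H2_bdry_L2 inner_fmult_H2)

lemma model_space_cmult:
  assumes "f \<in> model_space I"
  shows "(\<lambda>z\<in>disk. c * f z) \<in> model_space I"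
  using assms H2_inner_cmult_left[OF model_space_H2[OF assms] inner_fmult_H2]
  by (intro model_spaceI) (auto simp: model_space_orthogonal model_space_H2 H2_cmult H2_inner_def)

text \<open>
  The orthogonal projection onto \<open>K\<^sub>I\<close> in terms of the Riesz projection: \<open>P\<^sub>+\<close> projects onto \<open>H\<^sup>2\<close>, and \<open>u \<mapsto> I P\<^sub>+ (cnj I u)\<close> onto \<open>I H\<^sup>2\<close>.
\<close>

definition explicit_proj :: "(complex \<Rightarrow> complex) \<Rightarrow> complex \<Rightarrow> complex" where
  "explicit_proj u = fdiff (riesz_proj u) (fmult I (riesz_proj (\<lambda>\<zeta>. u \<zeta> * cnj (bdry I \<zeta>))))"

text \<open>
  Against \<open>I k\<close>, both \<open>P\<^sub>+ u\<close> and \<open>I P\<^sub>+ (cnj I u)\<close> have the inner product \<open>\<langle>u, I k\<rangle>\<close>, since multiplication by \<open>I\<close> is isometric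
  with adjoint \<open>cnj I\<close>; so their difference is orthogonal to \<open>I H\<^sup>2\<close>. The part \<open>I P\<^sub>+ (cnj I u)\<close> is orthogonal to \<open>K\<^sub>I\<close> by definition of \<open>K\<^sub>I\<close>.
\<close>

lemma
  assumes u: "u \<in> L2_circle"
  shows explicit_proj_in: "explicit_proj u \<in> model_space I"
    and explicit_proj_orthogonal: "h \<in> model_space I \<Longrightarrow>
      L2_inner (\<lambda>\<zeta>. u \<zeta> - bdry (explicit_proj u) \<zeta>) (bdry h) = 0"
proof -
  define v where "v = (\<lambda>\<zeta>. u \<zeta> * cnj (bdry I \<zeta>))"
  have v: "v \<in> L2_circle" unfolding v_def by (rule bdry_inner_L2(2)[OF u])
  note R = riesz_proj_H2[OF u] riesz_proj_H2[OF v]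
  have eq: "explicit_proj u = fdiff (riesz_proj u) (fmult I (riesz_proj v))"
    by (simp add: explicit_proj_def v_def)
  have H2: "explicit_proj u \<in> H2"
    unfolding eq by (intro H2_fdiff inner_fmult_H2 R)
  show "explicit_proj u \<in> model_space I"
  proof (rule model_spaceI[OF H2])
    fix k assume k: "k \<in> H2"
    have "L2_inner (bdry (riesz_proj u)) (bdry (fmult I k)) = L2_inner v (bdry k)"
      unfolding v_def using k by (simp add: riesz_proj_inner u inner_fmult_H2 L2_inner_inner_adjoint)
    moreover have "L2_inner (bdry (fmult I (riesz_proj v))) (bdry (fmult I k)) = L2_inner v (bdry k)"
      using k by (simp add: inner_mult_isometry R riesz_proj_inner v)
    ultimately show "L2_inner (bdry (explicit_proj u)) (bdry (fmult I k)) = 0"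
      unfolding eq by (simp add: L2_inner_bdry_fdiff_left R inner_fmult_H2 H2_bdry_L2 k)
  qed
  show "L2_inner (\<lambda>\<zeta>. u \<zeta> - bdry (explicit_proj u) \<zeta>) (bdry h) = 0" if h: "h \<in> model_space I"
  proof -
    have "L2_inner (bdry (fmult I (riesz_proj v))) (bdry h) = 0"
      by (subst L2_inner_commute) (simp add: model_space_orthogonal h R)
    then show ?thesis
      using h by (simp add: L2_inner_diff_left u H2_bdry_L2 H2 model_space_H2)
        (simp add: eq L2_inner_bdry_fdiff_left R inner_fmult_H2 H2_bdry_L2 model_space_H2 riesz_proj_inner u)
  qed
qed

text \<open>
  The difference of two candidates lies in the model space and is orthogonal to it, hence has norm \<open>0\<close>.
\<close>

lemma model_proj_unique:
  assumes u: "u \<in> L2_circle"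
    and "p \<in> model_space I" "\<And>h. h \<in> model_space I \<Longrightarrow> L2_inner (\<lambda>\<zeta>. u \<zeta> - bdry p \<zeta>) (bdry h) = 0"
    and "q \<in> model_space I" "\<And>h. h \<in> model_space I \<Longrightarrow> L2_inner (\<lambda>\<zeta>. u \<zeta> - bdry q \<zeta>) (bdry h) = 0"
  shows "p = q"
proof -
  have pq: "p \<in> H2" "q \<in> H2" using assms by (auto simp: model_space_H2)
  have d: "fdiff p q \<in> model_space I" by (intro model_space_fdiff assms)
  have "L2_inner (bdry p) (bdry (fdiff p q)) = L2_inner (bdry q) (bdry (fdiff p q))"
    using assms(3)[OF d] assms(5)[OF d]
    by (simp add: L2_inner_diff_left u pq H2_bdry_L2 H2_fdiff)
  then have "L2_inner (bdry (fdiff p q)) (bdry (fdiff p q)) = 0"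
    by (simp add: L2_inner_bdry_fdiff_left pq H2_bdry_L2 H2_fdiff)
  then have "(H2_norm (fdiff p q))\<^sup>2 = 0"
    by (simp add: H2_norm_sq H2_fdiff pq L2_inner_self)
  then show ?thesis by (intro H2_fdiff_eq_0_imp_eq pq) simp
qed

lemma model_proj_eq_explicit:
  assumes u: "u \<in> L2_circle"
  shows "model_proj I u = explicit_proj u"
  unfolding model_proj_def
  by (rule the_equality) (use model_proj_unique[OF u] explicit_proj_in[OF u] explicit_proj_orthogonal[OF u] in blast)+

lemma model_proj_in: "u \<in> L2_circle \<Longrightarrow> model_proj I u \<in> model_space I"
  by (simp add: model_proj_eq_explicit explicit_proj_in)

text \<open>
  The defining condition of the projection refers to \<open>u\<close> through integrals only.
\<close>

lemma model_proj_AE_cong: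
  assumes "circle_measurable u" "circle_measurable v" "AE \<theta> in circ. u (cis \<theta>) = v (cis \<theta>)"
  shows "model_proj I u = model_proj I v"
proof -
  have "L2_inner (\<lambda>\<zeta>. u \<zeta> - bdry p \<zeta>) (bdry h) = L2_inner (\<lambda>\<zeta>. v \<zeta> - bdry p \<zeta>) (bdry h)"
    if "p \<in> model_space I" "h \<in> model_space I" for p h
    using that assms
    by (intro L2_inner_AE_cong circle_measurable_diff H2_bdry_measurable model_space_H2)
      (auto elim: eventually_mono)
  then show ?thesis unfolding model_proj_def by (intro arg_cong[where f = The] ext) auto
qed

text \<open>
  This Fourier coefficient is the conjugate of the mean of \<open>z\<^sup>j\<^sup>-\<^sup>k I\<close> over the circle, which is the value
  of that function at \<open>0\<close>, namely \<open>0\<close> for \<open>k < j\<close>.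
\<close>

lemma inner_times_monomial_coeff:
  assumes "k < j"
  shows "L2_inner (\<lambda>\<zeta>. \<zeta> ^ k * cnj (bdry I \<zeta>)) (\<lambda>\<zeta>. \<zeta> ^ j) = 0"
proof -
  define e where "e = (\<lambda>z\<in>disk. z ^ (j - k))"
  have e: "e holomorphic_on disk"
    unfolding e_def by (rule holomorphic_transform[of "\<lambda>z. z ^ (j - k)"]) (auto intro!: holomorphic_intros)
  have e_le: "cmod (e z) \<le> 1" if "z \<in> disk" for z
    using that by (simp add: e_def norm_power power_le_one)
  have eI: "fmult e I \<in> H2" by (rule fmult_bounded_H2[OF e e_le inner_H2])
  have "bounded (e ` disk)" using e_le unfolding bounded_iff by blast
  then have eH2: "e \<in> H2" by (intro bounded_holomorphic_H2 e) (simp add: e_def)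
  have bdry_e: "bdry e (cis \<theta>) = cis \<theta> ^ (j - k)" for \<theta>
  proof (rule bdry_eqI)
    have "has_nt_limit (\<lambda>z. z ^ (j - k)) (cis \<theta>) (cis \<theta> ^ (j - k))"
      by (auto simp: has_nt_limit_def intro!: tendsto_intros)
    then show "has_nt_limit e (cis \<theta>) (cis \<theta> ^ (j - k))"
      by (subst has_nt_limit_cong[of _ "\<lambda>z. z ^ (j - k)"]) (auto simp: e_def)
  qed simp
  have pt: "cis \<theta> ^ k * cnj (bdry I (cis \<theta>)) * cnj (cis \<theta> ^ j) = cnj (bdry e (cis \<theta>) * bdry I (cis \<theta>))" for \<theta>
  proof -
    have "cis \<theta> ^ k * cnj (cis \<theta> ^ k) = 1"
      by (simp add: cis_cnj cis_mult flip: power_mult_distrib)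
    moreover have "cis \<theta> ^ j = cis \<theta> ^ k * cis \<theta> ^ (j - k)"
      using assms by (simp flip: power_add)
    ultimately show ?thesis by (simp add: bdry_e mult_ac del: complex_cnj_power)
  qed
  have "L2_inner (\<lambda>\<zeta>. \<zeta> ^ k * cnj (bdry I \<zeta>)) (\<lambda>\<zeta>. \<zeta> ^ j) = cnj (L2_inner (\<lambda>\<zeta>. bdry e \<zeta> * bdry I \<zeta>) (\<lambda>\<zeta>. 1))"
    unfolding L2_inner_def pt Bochner_Integration.integral_cnj by simp
  also have "L2_inner (\<lambda>\<zeta>. bdry e \<zeta> * bdry I \<zeta>) (\<lambda>\<zeta>. 1) = L2_inner (bdry (fmult e I)) (\<lambda>\<zeta>. 1)"
    using bdry_fmult[OF eH2 inner_H2]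
    by (intro L2_inner_AE_cong circle_measurable_mult H2_bdry_measurable eH2 inner_H2 eI
        circle_measurable_continuous continuous_intros) (auto elim: eventually_mono)
  also have "\<dots> = 0"
    unfolding H2_value_at_0[OF eI] using assms by (simp add: fmult_def e_def)
  finally show ?thesis by simp
qed

text \<open>
  If only finitely many of the coefficients survive, the Riesz projection is a polynomial.
\<close>

lemma riesz_proj_bounded:
  assumes "\<And>j. j \<ge> n \<Longrightarrow> L2_inner u (\<lambda>\<zeta>. \<zeta> ^ j) = 0"
  shows "bounded (riesz_proj u ` disk)"
proof -
  define c where "c k = L2_inner u (\<lambda>\<zeta>. \<zeta> ^ k)" for k
  have "cmod (riesz_proj u z) \<le> (\<Sum>k<n. cmod (c k))" if z: "z \<in> disk" for z
  proof -
    have "(\<Sum>k. c k * z ^ k) = (\<Sum>k<n. c k * z ^ k)"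
      by (rule suminf_finite) (use assms in \<open>auto simp: c_def\<close>)
    then have "riesz_proj u z = (\<Sum>k<n. c k * z ^ k)"
      using z by (simp add: riesz_proj_def c_def)
    also have "cmod \<dots> \<le> (\<Sum>k<n. cmod (c k))"
      using z by (intro order_trans[OF norm_sum] sum_mono) (simp add: norm_mult norm_power mult_left_le power_le_one)
    finally show ?thesis .
  qed
  then show ?thesis unfolding bounded_iff by blast
qed

text \<open>
  In \<open>P\<^sub>I s = P\<^sub>+ s - I P\<^sub>+ (cnj I s)\<close> both Riesz projections are polynomials of degree below \<open>n\<close>, and \<open>I\<close> is bounded.
\<close>

lemma model_proj_polynomial_bounded:
  "model_proj I (\<lambda>\<zeta>. \<Sum>k<n. a k * \<zeta> ^ k) \<in> model_space_bounded I"
proof -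
  define s where "s \<zeta> = (\<Sum>k<n. a k * \<zeta> ^ k)" for \<zeta>
  have s: "s \<in> L2_circle" unfolding s_def by (rule L2_circle_polynomial)
  have "L2_inner s (\<lambda>\<zeta>. \<zeta> ^ j) = 0" if "j \<ge> n" for j
    using that by (simp add: s_def[abs_def] L2_inner_polynomial_monomial)
  then have "bounded (riesz_proj s ` disk)" by (rule riesz_proj_bounded)
  then obtain B1 where B1: "\<And>z. z \<in> disk \<Longrightarrow> cmod (riesz_proj s z) \<le> B1"
    unfolding bounded_iff by (metis imageI)
  have "L2_inner (\<lambda>\<zeta>. s \<zeta> * cnj (bdry I \<zeta>)) (\<lambda>\<zeta>. \<zeta> ^ j) = 0" if "j \<ge> n" for j
  proof -
    have "L2_inner (\<lambda>\<zeta>. s \<zeta> * cnj (bdry I \<zeta>)) (\<lambda>\<zeta>. \<zeta> ^ j)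
        = (\<Sum>k<n. L2_inner (\<lambda>\<zeta>. a k * (\<zeta> ^ k * cnj (bdry I \<zeta>))) (\<lambda>\<zeta>. \<zeta> ^ j))"
      unfolding s_def sum_distrib_right mult.assoc
      by (rule L2_inner_sum_left) (intro L2_circle_cmult bdry_inner_L2 L2_circle_power)+
    also have "\<dots> = 0"
      using that by (simp add: L2_inner_cmult_left inner_times_monomial_coeff)
    finally show ?thesis .
  qed
  then have "bounded (riesz_proj (\<lambda>\<zeta>. s \<zeta> * cnj (bdry I \<zeta>)) ` disk)" by (rule riesz_proj_bounded)
  then obtain B2 where B2: "\<And>z. z \<in> disk \<Longrightarrow> cmod (riesz_proj (\<lambda>\<zeta>. s \<zeta> * cnj (bdry I \<zeta>)) z) \<le> B2"
    unfolding bounded_iff by (metis imageI)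
  obtain B where B: "\<And>z. z \<in> disk \<Longrightarrow> cmod (I z) \<le> B" using inner_bounded by blast
  have "cmod (model_proj I s z) \<le> B1 + B * B2" if z: "z \<in> disk" for z
  proof -
    have "cmod (model_proj I s z)
        \<le> cmod (riesz_proj s z) + cmod (I z) * cmod (riesz_proj (\<lambda>\<zeta>. s \<zeta> * cnj (bdry I \<zeta>)) z)"
      using z by (simp add: model_proj_eq_explicit s explicit_proj_def fdiff_def fmult_def
        norm_mult[symmetric] norm_triangle_ineq4)
    also have "\<dots> \<le> B1 + B * B2"
      using order_trans[OF norm_ge_zero B[OF z]] by (intro add_mono mult_mono B1 B B2 z) auto
    finally show ?thesis .
  qed
  then have "bounded (model_proj I s ` disk)" unfolding bounded_iff by blast
  then show ?thesis
    using model_proj_in[OF s] by (simp add: model_space_bounded_def s_def[abs_def])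
qed

text \<open>
  Pythagoras: \<open>f - s\<close> is the sum of \<open>f - P\<^sub>I s\<close>, which lies in the model space, and \<open>P\<^sub>I s - s\<close>, which is orthogonal to it.
\<close>

lemma model_proj_distance:
  assumes f: "f \<in> model_space I" and s: "s \<in> L2_circle"
  shows "(H2_norm (fdiff f (model_proj I s)))\<^sup>2 \<le> L2_normsq (\<lambda>\<zeta>. bdry f \<zeta> - s \<zeta>)"
proof -
  define p where "p = model_proj I s"
  have p: "p \<in> model_space I" unfolding p_def by (rule model_proj_in[OF s])
  have fp: "f \<in> H2" "p \<in> H2" using f p by (auto simp: model_space_H2)
  define d where "d = bdry (fdiff f p)"
  define r where "r = (\<lambda>\<zeta>. s \<zeta> - bdry p \<zeta>)"
  have d: "d \<in> L2_circle" unfolding d_def by (intro H2_bdry_L2 H2_fdiff fp)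
  have r: "r \<in> L2_circle" unfolding r_def by (intro L2_circle_diff s H2_bdry_L2 fp)
  have "L2_inner r d = 0"
    unfolding r_def d_def using explicit_proj_orthogonal[OF s model_space_fdiff[OF f p]]
    by (simp add: p_def model_proj_eq_explicit s)
  then have "L2_inner d r = 0" by (subst L2_inner_commute) simp
  have "L2_normsq (\<lambda>\<zeta>. bdry f \<zeta> - s \<zeta>) = L2_normsq (\<lambda>\<zeta>. d \<zeta> - r \<zeta>)"
    unfolding d_def r_def using bdry_fdiff[OF fp]
    by (intro L2_normsq_AE_cong circle_measurable_diff H2_bdry_measurable H2_fdiff fp L2_circle_measurable[OF s])
      (auto elim: eventually_mono)
  also have "\<dots> = L2_normsq d + L2_normsq r"
    using \<open>L2_inner d r = 0\<close> by (simp add: L2_normsq_diff d r)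
  finally have "L2_normsq d \<le> L2_normsq (\<lambda>\<zeta>. bdry f \<zeta> - s \<zeta>)"
    using L2_normsq_nonneg[of r] by linarith
  then show ?thesis by (simp add: H2_norm_sq H2_fdiff fp d_def flip: p_def)
qed

text \<open>
  The projections of the Taylor polynomials of \<open>f\<close> are bounded and approximate \<open>f\<close> at least as well as the
  polynomials themselves do.
\<close>

lemma model_space_bounded_dense:
  assumes f: "f \<in> model_space I" and "\<epsilon> > 0"
  shows "\<exists>h\<in>model_space_bounded I. H2_norm (fdiff f h) < \<epsilon>"
proof -
  obtain a where a: "h2_series a f" using model_space_H2[OF f] by (rule H2_imp_h2_series)
  have "\<forall>\<^sub>F n in sequentially. L2_normsq (\<lambda>\<zeta>. bdry f \<zeta> - (\<Sum>k<n. a k * \<zeta> ^ k)) < \<epsilon>\<^sup>2"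
    using \<open>\<epsilon> > 0\<close> by (intro order_tendstoD(2)[OF bdry_L2_approx[OF a]]) simp
  then obtain n where n: "L2_normsq (\<lambda>\<zeta>. bdry f \<zeta> - (\<Sum>k<n. a k * \<zeta> ^ k)) < \<epsilon>\<^sup>2"
    by (auto simp: eventually_sequentially)
  define h where "h = model_proj I (\<lambda>\<zeta>. \<Sum>k<n. a k * \<zeta> ^ k)"
  have "(H2_norm (fdiff f h))\<^sup>2 < \<epsilon>\<^sup>2"
    using model_proj_distance[OF f L2_circle_polynomial[of a "{..<n}"]] n by (simp add: h_def)
  then have "H2_norm (fdiff f h) < \<epsilon>"
    using \<open>\<epsilon> > 0\<close> by (simp add: power2_less_imp_less)
  moreover have "h \<in> model_space_bounded I"
    unfolding h_def by (rule model_proj_polynomial_bounded)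
  ultimately show ?thesis by blast
qed

lemma TTO_symbol_times_bounded:
  assumes "\<psi> \<in> L2_circle" "h \<in> model_space_bounded I"
  shows "(\<lambda>\<zeta>. \<psi> \<zeta> * bdry h \<zeta>) \<in> L2_circle"
proof -
  have h: "h \<in> H2" "bounded (h ` disk)"
    using assms(2) by (auto simp: model_space_bounded_def model_space_H2)
  then obtain B where B: "\<And>z. z \<in> disk \<Longrightarrow> cmod (h z) \<le> B"
    unfolding bounded_iff by (metis imageI)
  show ?thesis
    by (rule L2_circle_mult_bounded[OF assms(1) H2_bdry_measurable[OF h(1)] bdry_bounded[OF h(1) B]])
qed

lemma TTO_densely_defined:
  assumes "\<psi> \<in> L2_circle"
  shows "dom (TTO I \<psi>) = model_space_bounded I" "densely_defined_on (model_space I) (TTO I \<psi>)"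
proof -
  show dom: "dom (TTO I \<psi>) = model_space_bounded I"
    by (auto simp: TTO_def split: if_splits)
  show "densely_defined_on (model_space I) (TTO I \<psi>)"
    unfolding densely_defined_on_def dom
  proof (intro conjI ballI allI impI model_space_bounded_dense)
    show "model_space_bounded I \<subseteq> model_space I" by (auto simp: model_space_bounded_def)
    show "ran (TTO I \<psi>) \<subseteq> model_space I"
      by (auto simp: ran_def TTO_def split: if_splits intro!: model_proj_in TTO_symbol_times_bounded assms)
  qed
qed

end

section \<open>Conjugation by the isometric multiplier\<close>

lemma model_space_bounded_subset: "h \<in> model_space_bounded I \<Longrightarrow> h \<in> model_space I"
  by (simp add: model_space_bounded_def)

context
  fixes M :: "(complex \<Rightarrow> complex) set" and g I :: "complex \<Rightarrow> complex"
  assumes rep: "nearly_invariant_rep M g I"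
begin

lemma rep_inner: "inner_function I"
  using rep by (simp add: nearly_invariant_rep_def)

lemma rep_range: "M = fmult g ` model_space I"
  using rep by (simp add: nearly_invariant_rep_def)

lemma rep_M_H2: "f \<in> M \<Longrightarrow> f \<in> H2"
proof -
  have "M \<subseteq> H2"
    using rep unfolding nearly_invariant_rep_def nearly_invariant_def closed_subspace_H2_def
    by (elim conjE)
  then show "f \<in> M \<Longrightarrow> f \<in> H2" by blast
qed

lemma rep_g_H2: "g \<in> H2"
proof (rule rep_M_H2)
  show "g \<in> M"
    using rep unfolding nearly_invariant_rep_def extremal_function_def solves_extremal_problem_def
    by (elim conjE)
qed

lemma rep_fmult_H2: "h \<in> model_space I \<Longrightarrow> fmult g h \<in> H2"
  by (rule rep_M_H2) (subst rep_range, rule imageI)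

lemma rep_isometry: "h \<in> model_space I \<Longrightarrow> H2_norm (fmult g h) = H2_norm h"
  using rep by (simp add: nearly_invariant_rep_def)

lemma fmult_fdiff: "fmult g (fdiff h k) = fdiff (fmult g h) (fmult g k)"
  by (auto simp: fmult_def fdiff_def right_diff_distrib restrict_def)

lemma fmult_cmult: "fmult g (\<lambda>z\<in>disk. c * h z) = (\<lambda>z\<in>disk. c * fmult g h z)"
  by (auto simp: fmult_def restrict_def)

text \<open>
  An isometry is injective; so \<open>g h\<close> determines whether \<open>h\<close> is bounded.
\<close>

lemma U_injective:
  assumes "h \<in> model_space I" "k \<in> model_space I" "fmult g h = fmult g k"
  shows "h = k"
proof (rule H2_fdiff_eq_0_imp_eq)
  have hk: "fdiff h k \<in> model_space I" by (rule model_space_fdiff[OF rep_inner assms(1,2)])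
  have "(H2_norm (fdiff h k))\<^sup>2 = (H2_norm (fdiff (fmult g h) (fmult g h)))\<^sup>2"
    using rep_isometry[OF hk] assms(3) by (simp add: fmult_fdiff)
  also have "\<dots> = 0"
    using rep_fmult_H2[OF assms(1)] by (simp add: H2_norm_fdiff_sq H2_inner_self flip: of_real_power)
  finally show "H2_norm (fdiff h k) = 0" by simp
qed (use assms model_space_H2 in auto)

text \<open>
  Polarisation: comparing \<open>\<parallel>x - y\<parallel>\<^sup>2\<close> before and after multiplication by \<open>g\<close> gives the real parts, and replacing \<open>x\<close> by \<open>\<i> x\<close>
  gives the imaginary parts.
\<close>

lemma U_preserves_inner:
  assumes h: "h \<in> model_space I" and k: "k \<in> model_space I"
  shows "H2_inner (fmult g h) (fmult g k) = H2_inner h k"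
proof -
  have re: "Re (H2_inner (fmult g x) (fmult g y)) = Re (H2_inner x y)"
    if x: "x \<in> model_space I" and y: "y \<in> model_space I" for x y
  proof -
    have "(H2_norm (fdiff (fmult g x) (fmult g y)))\<^sup>2 = (H2_norm (fdiff x y))\<^sup>2"
      using rep_isometry[OF model_space_fdiff[OF rep_inner x y]] by (simp add: fmult_fdiff)
    then show ?thesis
      using x y by (simp add: H2_norm_fdiff_sq rep_fmult_H2 model_space_H2 rep_isometry)
  qed
  have "Re (H2_inner (fmult g (\<lambda>z\<in>disk. \<i> * h z)) (fmult g k)) = Re (H2_inner (\<lambda>z\<in>disk. \<i> * h z) k)"
    by (rule re[OF model_space_cmult[OF rep_inner h] k])
  then have "Im (H2_inner (fmult g h) (fmult g k)) = Im (H2_inner h k)"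
    using h k by (simp add: fmult_cmult H2_inner_cmult_left rep_fmult_H2 model_space_H2)
  with re[OF h k] show ?thesis by (simp add: complex_eq_iff)
qed

text \<open>
  As \<open>U\<^sub>g\<close> preserves inner products, \<open>p\<close> satisfies the condition that defines the adjoint at \<open>g p\<close>; no other element of the
  model space does, since two solutions differ by an element orthogonal to the whole model space.
\<close>

lemma U_adjoint:
  assumes p: "p \<in> model_space I"
  shows "adjoint_op (model_space I) M (U_op g I) (fmult g p) = Some p"
proof -
  define is_adj where "is_adj k \<longleftrightarrow> k \<in> model_space I \<and>
      (\<forall>h\<in>dom (U_op g I). H2_inner (the (U_op g I h)) (fmult g p) = H2_inner h k)" for k
  have dom: "dom (U_op g I) = model_space I" by (auto simp: U_op_def split: if_splits)
  have adj: "is_adj p"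
    using p by (simp add: is_adj_def dom U_preserves_inner) (simp add: U_op_def U_preserves_inner)
  have uniq: "k = p" if "is_adj k" for k
  proof -
    have k: "k \<in> model_space I" and eq: "\<And>h. h \<in> model_space I \<Longrightarrow> H2_inner h p = H2_inner h k"
      using that adj by (auto simp: is_adj_def dom)
    have H2: "k \<in> H2" "p \<in> H2" using k p by (auto simp: model_space_H2)
    have "H2_inner (fdiff k p) (fdiff k p) = 0"
      using eq[OF model_space_fdiff[OF rep_inner k p]] H2 by (simp add: H2_inner_fdiff_right H2_fdiff)
    then have "H2_norm (fdiff k p) = 0" using H2 by (simp add: H2_inner_self H2_fdiff flip: of_real_power)
    then show ?thesis by (rule H2_fdiff_eq_0_imp_eq[OF H2])
  qed
  have "(THE k. is_adj k) = p" using adj uniq by (rule the_equality)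
  moreover have "fmult g p \<in> M" using p by (simp add: rep_range)
  ultimately show ?thesis
    using adj unfolding adjoint_op_def is_adj_def[abs_def] Let_def by auto
qed

end

theorem theorem3p1:
  fixes M :: "(complex \<Rightarrow> complex) set" and g I \<phi> :: "complex \<Rightarrow> complex"
  assumes "nearly_invariant_rep M g I"
    and "circle_measurable \<phi>"
    and "(\<lambda>\<zeta>. of_real ((cmod (bdry g \<zeta>))\<^sup>2) * \<phi> \<zeta>) \<in> L2_circle"
  shows "adjoint_op (model_space I) M (U_op g I) \<circ>\<^sub>m TTO_nearly g I \<phi> \<circ>\<^sub>m U_op g I
           = TTO I (\<lambda>\<zeta>. of_real ((cmod (bdry g \<zeta>))\<^sup>2) * \<phi> \<zeta>)
       \<and> dom (TTO I (\<lambda>\<zeta>. of_real ((cmod (bdry g \<zeta>))\<^sup>2) * \<phi> \<zeta>)) = model_space_bounded I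
       \<and> densely_defined_on (model_space I) (TTO I (\<lambda>\<zeta>. of_real ((cmod (bdry g \<zeta>))\<^sup>2) * \<phi> \<zeta>))"
proof (intro conjI ext)
  define \<psi> where "\<psi> \<zeta> = of_real ((cmod (bdry g \<zeta>))\<^sup>2) * \<phi> \<zeta>" for \<zeta>
  have psi: "\<psi> \<in> L2_circle" using assms(3) by (simp add: \<psi>_def[abs_def])
  note inner = rep_inner[OF assms(1)]
  have gH2: "g \<in> H2" by (rule rep_g_H2[OF assms(1)])
  show "dom (TTO I (\<lambda>\<zeta>. of_real ((cmod (bdry g \<zeta>))\<^sup>2) * \<phi> \<zeta>)) = model_space_bounded I"
    "densely_defined_on (model_space I) (TTO I (\<lambda>\<zeta>. of_real ((cmod (bdry g \<zeta>))\<^sup>2) * \<phi> \<zeta>))"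
    using TTO_densely_defined[OF inner assms(3)] by blast+
  fix h
  show "(adjoint_op (model_space I) M (U_op g I) \<circ>\<^sub>m TTO_nearly g I \<phi> \<circ>\<^sub>m U_op g I) h
      = TTO I (\<lambda>\<zeta>. of_real ((cmod (bdry g \<zeta>))\<^sup>2) * \<phi> \<zeta>) h"
  proof (cases "h \<in> model_space_bounded I")
    case False
    have "TTO_nearly g I \<phi> (fmult g h) = None" if "h \<in> model_space I"
    proof -
      have "fmult g h \<notin> fmult g ` model_space_bounded I"
        using False that U_injective[OF assms(1)] model_space_bounded_subset by blast
      then show ?thesis by (simp add: TTO_nearly_def)
    qed
    then have "(adjoint_op (model_space I) M (U_op g I) \<circ>\<^sub>m TTO_nearly g I \<phi> \<circ>\<^sub>m U_op g I) h = None"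
      by (simp add: map_comp_def U_op_def)
    with False show ?thesis by (simp add: TTO_def)
  next
    case True
    then have h: "h \<in> model_space I" by (rule model_space_bounded_subset)
    have hH2: "h \<in> H2" by (rule model_space_H2[OF h])
    have ghH2: "fmult g h \<in> H2" by (rule rep_fmult_H2[OF assms(1) h])
    have u: "(\<lambda>\<zeta>. \<psi> \<zeta> * bdry h \<zeta>) \<in> L2_circle"
      by (rule TTO_symbol_times_bounded[OF inner psi True])
    have "model_proj I (\<lambda>\<zeta>. cnj (bdry g \<zeta>) * \<phi> \<zeta> * bdry (fmult g h) \<zeta>) = model_proj I (\<lambda>\<zeta>. \<psi> \<zeta> * bdry h \<zeta>)"
    proof (rule model_proj_AE_cong[OF inner])
      show "circle_measurable (\<lambda>\<zeta>. cnj (bdry g \<zeta>) * \<phi> \<zeta> * bdry (fmult g h) \<zeta>)"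
        by (intro circle_measurable_mult circle_measurable_cnj H2_bdry_measurable gH2 ghH2 assms(2))
      show "circle_measurable (\<lambda>\<zeta>. \<psi> \<zeta> * bdry h \<zeta>)" by (rule L2_circle_measurable[OF u])
      show "AE \<theta> in circ. cnj (bdry g (cis \<theta>)) * \<phi> (cis \<theta>) * bdry (fmult g h) (cis \<theta>) = \<psi> (cis \<theta>) * bdry h (cis \<theta>)"
        using bdry_fmult[OF gH2 hH2]
        by eventually_elim (simp add: \<psi>_def complex_norm_square mult_ac del: of_real_power)
    qed
    then have "TTO_nearly g I \<phi> (fmult g h) = Some (fmult g (model_proj I (\<lambda>\<zeta>. \<psi> \<zeta> * bdry h \<zeta>)))"
      using True by (simp add: TTO_nearly_def)
    moreover have "adjoint_op (model_space I) M (U_op g I) (fmult g (model_proj I (\<lambda>\<zeta>. \<psi> \<zeta> * bdry h \<zeta>)))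
        = Some (model_proj I (\<lambda>\<zeta>. \<psi> \<zeta> * bdry h \<zeta>))"
      by (rule U_adjoint[OF assms(1) model_proj_in[OF inner u]])
    ultimately show ?thesis
      using h True by (simp add: map_comp_def U_op_def TTO_def \<psi>_def)
  qed
qed

end
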